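(* Let $\mathit{pw}(n)$ be a function of $n$ and let $\mathcal{G}$ be the family of (connected) graphs of pathwidth at most $\mathit{pw}(n)$. Let $\delta_{\mathcal{G}}(n)=\max\{\delta(\mathcal{A}(G)) : G\in\mathcal{G},\ |V(G)|=n\}$. Then $$\Omega(\mathit{pw}(n)\cdot n)\le \delta_{\mathcal{G}}(n)\le O(\mathit{pw}(n)\cdot n\log n).$$
   Context: All graphs are finite, simple and connected. For a graph $G=(V,E)$, a search tree on $G$ is a rooted tree with vertex set $V$ defined recursively: its root is some vertex $r\in V$, and $r$ is joined to the roots of search trees on each connected component of $G-r$. The tubes of a search tree are the vertex sets of its subtrees. Two search trees on $G$ are related by a rotation if their sets of tubes have symmetric difference of size exactly two. The graph associahedron $\mathcal{A}(G)$ is a polytope whose skeleton is isomorphic to the graph on search trees of $G$ with adjacency given by rotations; $\delta(\mathcal{A}(G))$ is the diameter of this graph. Pathwidth is the usual graph parameter (one less than the smallest clique number of an interval supergraph of $G$).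
   Formalization: It is assumed that pw(n) ≥ 1 for large n (otherwise the maximum is over no graphs), and, for the lower bound only, that pw(n) < n for large n: a graph on n vertices has pathwidth at most n-1, and the lower bound fails e.g. for pw(n) = n². *)

theory Defs
  imports
    "HOL-Library.FSet"
    "HOL-Library.Landau_Symbols"
    "Graph_Theory.Graph_Theory"
begin

text \<open>
  Finite simple graphs are symmetric loop-free digraphs (\<^locale>\<open>pair_graph\<close>). In such a graph the
  strongly connected components are the connected components.
\<close>

definition components :: "('a, 'b) pre_digraph \<Rightarrow> ('a, 'b) pre_digraph set" where
  "components G = pre_digraph.sccs G"

section \<open>Search trees and rotations\<close>

datatype 'a rtree = Node (root: 'a) (children: "'a rtree fset")

inductive search_tree :: "('a, 'b) pre_digraph \<Rightarrow> 'a rtree \<Rightarrow> bool" where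
  "r \<in> verts G \<Longrightarrow>
   (\<And>C. C \<in> components (pre_digraph.del_vert G r) \<Longrightarrow> search_tree C (t C)) \<Longrightarrow>
   fset Ts = t ` components (pre_digraph.del_vert G r) \<Longrightarrow>
   search_tree G (Node r Ts)"

primrec subtrees :: "'a rtree \<Rightarrow> 'a rtree set" where
  "subtrees (Node r Ts) = insert (Node r Ts) (\<Union> (fset (subtrees |`| Ts)))"

definition tubes :: "'a rtree \<Rightarrow> 'a set set" where
  "tubes T = set_rtree ` subtrees T"

text \<open>The skeleton of the graph associahedron of \<open>G\<close>.\<close>

definition rotation_graph :: "('a, 'b) pre_digraph \<Rightarrow> 'a rtree pair_pre_digraph" where
  "rotation_graph G =
    \<lparr> pverts = {T. search_tree G T},
      parcs = {(S, T). search_tree G S \<and> search_tree G T \<and> card (sym_diff (tubes S) (tubes T)) = 2} \<rparr>"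

text \<open>Distance and diameter are only meaningful for finite connected graphs.\<close>

definition graph_dist :: "('a, 'b) pre_digraph \<Rightarrow> 'a \<Rightarrow> 'a \<Rightarrow> nat" where
  "graph_dist G u v = (LEAST k. (u, v) \<in> arcs_ends G ^^ k)"

definition graph_diameter :: "('a, 'b) pre_digraph \<Rightarrow> nat" where
  "graph_diameter G = Max {graph_dist G u v | u v. u \<in> verts G \<and> v \<in> verts G}"

definition associahedron_diameter :: "('a, 'b) pre_digraph \<Rightarrow> nat" where
  "associahedron_diameter G = graph_diameter (rotation_graph G)"

section \<open>Pathwidth\<close>

definition interval_graph :: "'a pair_pre_digraph \<Rightarrow> bool" where
  "interval_graph H \<longleftrightarrow> pair_graph H \<and>
    (\<exists>a b :: 'a \<Rightarrow> real.
      (\<forall>v \<in> pverts H. a v \<le> b v) \<and>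
      (\<forall>u \<in> pverts H. \<forall>v \<in> pverts H. u \<noteq> v \<longrightarrow>
        ((u, v) \<in> parcs H \<longleftrightarrow> {a u..b u} \<inter> {a v..b v} \<noteq> {})))"

definition clique :: "'a pair_pre_digraph \<Rightarrow> 'a set \<Rightarrow> bool" where
  "clique H K \<longleftrightarrow> K \<subseteq> pverts H \<and> (\<forall>u \<in> K. \<forall>v \<in> K. u \<noteq> v \<longrightarrow> (u, v) \<in> parcs H)"

definition clique_number :: "'a pair_pre_digraph \<Rightarrow> nat" where
  "clique_number H = Max {card K | K. clique H K}"

definition pathwidth :: "'a pair_pre_digraph \<Rightarrow> nat" where
  "pathwidth G = (LEAST w. \<exists>H. interval_graph H \<and> subgraph G H \<and> clique_number H = w) - 1"

section \<open>Maximum diameter over a family of graphs\<close>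

text \<open>Vertices are natural numbers; every finite graph has an isomorphic copy of this form.\<close>

definition pathwidth_family :: "(nat \<Rightarrow> nat) \<Rightarrow> nat pair_pre_digraph set" where
  "pathwidth_family pw =
    {G. pair_graph G \<and> Digraph_Component.connected G \<and> pathwidth G \<le> pw (card (pverts G))}"

definition max_diameter :: "nat pair_pre_digraph set \<Rightarrow> nat \<Rightarrow> nat" where
  "max_diameter \<G> n = Max {associahedron_diameter (with_proj G) | G. G \<in> \<G> \<and> card (pverts G) = n}"

end

theory Submission
  imports Defs
begin

text \<open>
  Every linear order of the vertices yields a search tree: recursively, the earliest vertex of each
  component is its root. Its tubes are the components of the vertices in the corresponding
  suffixes of the order, every search tree arises in this way, and a transposition of two consecutive
  vertices of the order either fixes the tubes or exchanges exactly one tube, i.e. is a rotation.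

  Upper bound: moving \<open>r\<close> to the front of an order costs at most one rotation for every other vertex of the
  component of \<open>r\<close>, so every search tree is transformed into a given one \<open>T\<close> by at most as many rotations
  as the sum of the tube sizes of \<open>T\<close>. In an interval supergraph with clique number \<open>w\<close>, the at most \<open>w\<close>
  intervals over a median left endpoint separate a component into parts of at most half its size.
  Removing such separators level by level gives a tree in which the tube sizes add up to at most
  \<open>w (1 + log\<^sub>2 n) n\<close>.

  Lower bound: of the endpoints of an edge one is always above the other, and a rotation reverses this
  relation for at most one edge. Hence an order and its reverse are at distance at
  least the number of edges, which is at least \<open>k n / 2\<close> for the complete split graph that joins a clique
  on \<open>k < n\<close> vertices to \<open>n - k\<close> independent vertices.
\<close>

section \<open>Tubings of vertex orders\<close>

text \<open>The edge relation is fixed while the vertex set varies: deleting vertices only changes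
  the set on which components are formed.\<close>

locale sym_relation =
  fixes E :: "'a rel"
  assumes sym_E: "sym E"
begin

section \<open>Components of induced subgraphs\<close>

definition conn :: "'a set \<Rightarrow> 'a \<Rightarrow> 'a set" where
  "conn S v = {u. (v, u) \<in> rtrancl_on S E}"

lemma conn_self: "v \<in> S \<Longrightarrow> v \<in> conn S v"
  by (simp add: conn_def)

lemma conn_subset: "conn S v \<subseteq> S"
  by (auto simp: conn_def dest: in_rtrancl_on_in_F)

lemma conn_step: "u \<in> conn S v \<Longrightarrow> (u, w) \<in> E \<Longrightarrow> w \<in> S \<Longrightarrow> w \<in> conn S v"
  by (auto simp: conn_def intro: rtrancl_on_into_rtrancl_on)

lemma conn_trans: "u \<in> conn S v \<Longrightarrow> w \<in> conn S u \<Longrightarrow> w \<in> conn S v"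
  by (auto simp: conn_def intro: rtrancl_on_trans)

lemma conn_sym: "u \<in> conn S v \<Longrightarrow> v \<in> conn S u"
  using rtrancl_on_sym[OF sym_E, of S] by (auto simp: conn_def elim: symE)

lemma conn_eq: "u \<in> conn S v \<Longrightarrow> conn S u = conn S v"
  by (blast intro: conn_trans conn_sym)

lemma conn_mono: "S \<subseteq> S' \<Longrightarrow> conn S v \<subseteq> conn S' v"
  using rtrancl_on_mono[of E E S S'] by (auto simp: conn_def)

lemma conn_closed:
  assumes "v \<in> K" and "\<And>u w. u \<in> K \<Longrightarrow> u \<in> S \<Longrightarrow> w \<in> S \<Longrightarrow> (u, w) \<in> E \<Longrightarrow> w \<in> K"
  shows "conn S v \<subseteq> K"
proof
  fix u assume "u \<in> conn S v"
  then have "(v, u) \<in> rtrancl_on S E" by (simp add: conn_def)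
  then show "u \<in> K" using assms by (induction rule: rtrancl_on_induct) blast+
qed

text \<open>A walk inside \<open>S\<close> from \<open>v\<close> never leaves the component, so it
  is also a walk inside \<open>S'\<close>. This is how components in different suffixes of an order
  are compared.\<close>

lemma conn_restrict:
  assumes "conn S v \<subseteq> S'" and "S' \<subseteq> S"
  shows "conn S' v = conn S v"
proof (cases "v \<in> S")
  case True
  have "u \<in> conn S' v" if "(v, u) \<in> rtrancl_on S E" for u
    using that
  proof (induction rule: rtrancl_on_induct)
    case base
    then show ?case using assms conn_self by blast
  next
    case (step y z)
    have "z \<in> conn S v"
      using step(1,2,4) by (auto simp: conn_def intro: rtrancl_on_into_rtrancl_on)
    then show ?case using assms conn_step[OF step(5,2)] by blast
  qed
  then show ?thesis using conn_mono[OF assms(2)] by (auto simp: conn_def)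
next
  case False
  then have "conn S v = {}" "conn S' v = {}"
    using assms(2) by (auto simp: conn_def dest: in_rtrancl_on_in_F)
  then show ?thesis by simp
qed

text \<open>The tubes of the search tree in which the earliest vertex of each component is its root.\<close>

primrec tubing :: "'a list \<Rightarrow> 'a set set" where
  "tubing [] = {}"
| "tubing (v # vs) = insert (conn (set (v # vs)) v) (tubing vs)"

lemma tubing_subset: "t \<in> tubing vs \<Longrightarrow> t \<subseteq> set vs"
  by (induction vs) (use conn_subset in fastforce)+

lemma finite_tubing: "finite (tubing vs)"
  by (induction vs) auto

text \<open>The vertex that contributed the tube is the witness, since its component can only grow
  with the vertex set. Hence no tube meets two components.\<close>

lemma tubing_connected: "t \<in> tubing vs \<Longrightarrow> \<exists>v \<in> set vs. t \<subseteq> conn (set vs) v \<and> v \<in> t"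
proof (induction vs)
  case (Cons x xs)
  show ?case
  proof (cases "t = conn (set (x # xs)) x")
    case True
    then show ?thesis by (auto simp: conn_self)
  next
    case False
    then have "t \<in> tubing xs" using Cons.prems by auto
    then obtain v where "v \<in> set xs" "t \<subseteq> conn (set xs) v" "v \<in> t" using Cons.IH by blast
    then show ?thesis
      using conn_mono[of "set xs" "set (x # xs)" v] by (intro bexI[of _ v]) auto
  qed
qed simp

text \<open>Inside \<open>set vs\<close>, \<open>K\<close> is a union of components, so vertices
  outside it do not affect the tubes of those inside. A tube contributed from outside contains its
  own vertex and is not a subset of \<open>K\<close>.\<close>

lemma tubing_filter:
  assumes "\<And>u w. u \<in> K \<Longrightarrow> u \<in> set vs \<Longrightarrow> w \<in> set vs \<Longrightarrow> (u, w) \<in> E \<Longrightarrow> w \<in> K"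
  shows "tubing (filter (\<lambda>v. v \<in> K) vs) = {t \<in> tubing vs. t \<subseteq> K}"
  using assms
proof (induction vs)
  case (Cons x xs)
  have IH: "tubing (filter (\<lambda>v. v \<in> K) xs) = {t \<in> tubing xs. t \<subseteq> K}"
    by (rule Cons.IH) (use Cons.prems in auto)
  show ?case
  proof (cases "x \<in> K")
    case True
    have sub: "conn (set (x # xs)) x \<subseteq> K"
      by (rule conn_closed[OF True]) (use Cons.prems in auto)
    then have "conn (set (x # filter (\<lambda>v. v \<in> K) xs)) x = conn (set (x # xs)) x"
      by (intro conn_restrict) (use conn_subset[of "set (x # xs)" x] in auto)
    then show ?thesis using True IH sub by auto
  next
    case False
    then have "\<not> conn (set (x # xs)) x \<subseteq> K" using conn_self[of x "set (x # xs)"] by auto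
    then show ?thesis using False IH by auto
  qed
qed simp

lemma tubing_append:
  assumes "\<And>u w. u \<in> set xs \<Longrightarrow> w \<in> set ys \<Longrightarrow> (u, w) \<notin> E"
  shows "tubing (xs @ ys) = tubing xs \<union> tubing ys"
  using assms
proof (induction xs)
  case (Cons x xs)
  have "conn (set (x # xs @ ys)) x \<subseteq> set (x # xs)"
    by (rule conn_closed) (use Cons.prems in auto)
  then have "conn (set (x # xs)) x = conn (set (x # xs @ ys)) x"
    by (intro conn_restrict) auto
  then show ?case using Cons by simp
qed simp

text \<open>If \<open>a\<close> and \<open>b\<close> lie in different components, deleting one
  leaves the component of the other as it was. Otherwise both orders begin with the same tube, and
  only the second tube depends on which of the two comes first.\<close>

lemma tubing_swap:
  assumes "distinct (a # b # ys)"
  shows "tubing (a # b # ys) = tubing (b # a # ys) \<or>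
    b \<in> conn (set (a # b # ys)) a \<and> card (sym_diff (tubing (a # b # ys)) (tubing (b # a # ys))) = 2"
proof -
  let ?X = "set (a # b # ys)" and ?Xa = "set (a # ys)" and ?Xb = "set (b # ys)"
  have comm: "insert b (insert a (set ys)) = ?X" by auto
  show ?thesis
  proof (cases "b \<in> conn ?X a")
    case False
    then have "a \<notin> conn ?X b" using conn_sym by blast
    then have "conn ?Xb b = conn ?X b"
      by (intro conn_restrict) (use conn_subset[of ?X b] in auto)
    moreover have "conn ?Xa a = conn ?X a"
      by (intro conn_restrict) (use False conn_subset[of ?X a] in auto)
    ultimately show ?thesis by (auto simp: comm)
  next
    case True
    let ?A = "conn ?X a" and ?P = "conn ?Xb b" and ?Q = "conn ?Xa a"
    have A: "conn ?X b = ?A" using conn_eq[OF True] .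
    have "a \<in> ?A" "b \<in> ?A" "b \<in> ?P" "a \<in> ?Q"
      using True conn_self[of a ?X] conn_self[of b ?Xb] conn_self[of a ?Xa] by auto
    moreover have "a \<notin> ?P" "b \<notin> ?Q" using assms conn_subset[of ?Xb b] conn_subset[of ?Xa a] by auto
    moreover have "a \<notin> t" "b \<notin> t" if "t \<in> tubing ys" for t using assms tubing_subset[OF that] by auto
    \<comment> \<open>\<open>?P\<close> contains \<open>b\<close> but not \<open>a\<close>, and
      \<open>?Q\<close> the reverse, whereas \<open>?A\<close> contains both and later tubes
      neither.\<close>
    ultimately have "sym_diff ({?A, ?P} \<union> tubing ys) ({?A, ?Q} \<union> tubing ys) = {?P, ?Q}" "?P \<noteq> ?Q"
      by blast+
    moreover have "tubing (a # b # ys) = {?A, ?P} \<union> tubing ys" by auto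
    moreover have "tubing (b # a # ys) = {?A, ?Q} \<union> tubing ys" using A by (auto simp: comm)
    ultimately show ?thesis using True by simp
  qed
qed

section \<open>Rotation distance between tubings\<close>

text \<open>The symmetric difference is used, as in \<open>rotation_graph\<close>, rather than
  adjacent transpositions, so that walks transfer between trees and tubings in both
  directions.\<close>

definition rotations :: "'a set \<Rightarrow> 'a set set rel" where
  "rotations S = {(tubing xs, tubing ys) | xs ys. distinct xs \<and> distinct ys \<and> set xs = S \<and> set ys = S \<and>
     card (sym_diff (tubing xs) (tubing ys)) = 2}"

lemma rotationsI:
  "distinct xs \<Longrightarrow> distinct ys \<Longrightarrow> set xs = S \<Longrightarrow> set ys = S \<Longrightarrow>
    card (sym_diff (tubing xs) (tubing ys)) = 2 \<Longrightarrow> (tubing xs, tubing ys) \<in> rotations S"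
  unfolding rotations_def by blast

lemma rotationsE:
  assumes "(M, N) \<in> rotations S"
  obtains xs ys where "M = tubing xs" "N = tubing ys" "distinct xs" "distinct ys"
    "set xs = S" "set ys = S" "card (sym_diff M N) = 2"
  using assms unfolding rotations_def by auto

text \<open>The added tube contains \<open>v\<close>, so it is new to both tubings and cancels in
  the symmetric difference.\<close>

lemma rotations_Cons:
  assumes "(M, N) \<in> rotations S" and "v \<notin> S"
  shows "(insert (conn (insert v S) v) M, insert (conn (insert v S) v) N) \<in> rotations (insert v S)"
proof -
  from assms(1) obtain xs ys where xy: "M = tubing xs" "N = tubing ys" "distinct xs" "distinct ys"
    "set xs = S" "set ys = S" "card (sym_diff M N) = 2"
    by (rule rotationsE)
  let ?t = "conn (insert v S) v"
  have "v \<in> ?t" by (simp add: conn_self)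
  then have "?t \<notin> M" "?t \<notin> N" using xy tubing_subset assms(2) by blast+
  then have "sym_diff (insert ?t M) (insert ?t N) = sym_diff M N" by blast
  then have "card (sym_diff (tubing (v # xs)) (tubing (v # ys))) = 2" using xy by simp
  moreover have "distinct (v # xs)" "distinct (v # ys)" using xy assms(2) by auto
  moreover have "set (v # xs) = insert v S" "set (v # ys) = insert v S" using xy by auto
  moreover have "insert ?t M = tubing (v # xs)" "insert ?t N = tubing (v # ys)" using xy by auto
  ultimately show ?thesis using rotationsI by metis
qed

lemma sym_rotations: "sym (rotations S)"
proof (rule symI)
  fix M N assume "(M, N) \<in> rotations S"
  then show "(N, M) \<in> rotations S"
    by (elim rotationsE) (auto intro!: rotationsI simp: Un_commute)
qed

end

section \<open>Walks of bounded length\<close>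

definition steps_le :: "'b rel \<Rightarrow> nat \<Rightarrow> 'b rel" where
  "steps_le R k = (\<Union>j\<le>k. R ^^ j)"

lemma steps_le_refl: "(x, x) \<in> steps_le R k"
  by (auto simp: steps_le_def intro!: bexI[of _ 0])

lemma steps_le_step: "(x, y) \<in> R \<Longrightarrow> (x, y) \<in> steps_le R 1"
  by (auto simp: steps_le_def intro!: bexI[of _ 1])

lemma steps_le_trans:
  assumes "(x, y) \<in> steps_le R j" and "(y, z) \<in> steps_le R k"
  shows "(x, z) \<in> steps_le R (j + k)"
proof -
  from assms obtain i l where "i \<le> j" "l \<le> k" "(x, y) \<in> R ^^ i" "(y, z) \<in> R ^^ l"
    by (auto simp: steps_le_def)
  then have "i + l \<le> j + k" "(x, z) \<in> R ^^ (i + l)" by (auto simp: relpow_add)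
  then show ?thesis unfolding steps_le_def by blast
qed

lemma steps_le_mono: "(x, y) \<in> steps_le R j \<Longrightarrow> j \<le> k \<Longrightarrow> (x, y) \<in> steps_le R k"
  by (fastforce simp: steps_le_def)

lemma steps_le_sym:
  assumes "sym R" and "(x, y) \<in> steps_le R k"
  shows "(y, x) \<in> steps_le R k"
proof -
  have "(y, x) \<in> R ^^ j" if "(x, y) \<in> R ^^ j" for j
    using that
  proof (induction j arbitrary: y)
    case (Suc j)
    then obtain z where "(x, z) \<in> R ^^ j" "(z, y) \<in> R" by (auto elim: relpow_Suc_E)
    then show ?case using Suc.IH relpow_Suc_I2 symD[OF assms(1)] by metis
  qed simp
  then show ?thesis using assms(2) by (auto simp: steps_le_def)
qed

lemma steps_le_map:
  assumes "\<And>x y. (x, y) \<in> R \<Longrightarrow> (f x, f y) \<in> Q" and "(x, y) \<in> steps_le R k"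
  shows "(f x, f y) \<in> steps_le Q k"
proof -
  have "(f x, f y) \<in> Q ^^ j" if "(x, y) \<in> R ^^ j" for j
    using that by (induction j arbitrary: y) (auto intro: assms(1))
  then show ?thesis using assms(2) by (auto simp: steps_le_def)
qed

section \<open>Rotation distance and tube sizes\<close>

context sym_relation
begin

text \<open>By induction \<open>r\<close> first passes the tail of the prefix and then swaps with
  its head. A swap costs a rotation only for a vertex in the component of \<open>r\<close>, and
  components in suffixes lie inside the one in the whole order.\<close>

lemma move_to_front:
  assumes "distinct (xs @ r # ys)"
  shows "(tubing (xs @ r # ys), tubing (r # xs @ ys))
    \<in> steps_le (rotations (set (xs @ r # ys))) (card (set xs \<inter> conn (set (xs @ r # ys)) r))"
  using assms
proof (induction xs)
  case Nil
  then show ?case by (simp add: steps_le_refl)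
next
  case (Cons x xs)
  let ?S = "set (xs @ r # ys)" and ?T = "set (x # xs @ r # ys)"
  let ?c = "card (set xs \<inter> conn ?S r)"
  have T: "?T = insert x ?S" by auto
  have x: "x \<notin> ?S" using Cons.prems by auto
  have "(tubing (xs @ r # ys), tubing (r # xs @ ys)) \<in> steps_le (rotations ?S) ?c"
    using Cons by simp
  then have "(insert (conn ?T x) (tubing (xs @ r # ys)), insert (conn ?T x) (tubing (r # xs @ ys)))
      \<in> steps_le (rotations ?T) ?c"
    unfolding T by (rule steps_le_map[rotated]) (rule rotations_Cons[OF _ x])
  moreover have eqT: "set (x # r # xs @ ys) = ?T" "set (r # x # xs @ ys) = ?T" by auto
  ultimately have 1: "(tubing (x # xs @ r # ys), tubing (x # r # xs @ ys)) \<in> steps_le (rotations ?T) ?c"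
    unfolding tubing.simps(2) by presburger
  have d: "distinct (x # r # xs @ ys)" "distinct (r # x # xs @ ys)" using Cons.prems by auto
  \<comment> \<open>Cost of the last swap, which is free across different components.\<close>
  let ?d = "if x \<in> conn ?T r then 1 else 0 :: nat"
  have 2: "(tubing (x # r # xs @ ys), tubing (r # x # xs @ ys)) \<in> steps_le (rotations ?T) ?d"
  proof (cases "tubing (x # r # xs @ ys) = tubing (r # x # xs @ ys)")
    case True
    show ?thesis unfolding True by (rule steps_le_refl)
  next
    case False
    then have *: "r \<in> conn ?T x" "card (sym_diff (tubing (x # r # xs @ ys)) (tubing (r # x # xs @ ys))) = 2"
      using tubing_swap[OF d(1)] unfolding eqT by blast+
    then have "(tubing (x # r # xs @ ys), tubing (r # x # xs @ ys)) \<in> rotations ?T"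
      using d eqT by (intro rotationsI)
    then show ?thesis using conn_sym[OF *(1)] steps_le_step by simp
  qed
  have "?c + ?d \<le> card (set (x # xs) \<inter> conn ?T r)"
  proof -
    have "set xs \<inter> conn ?S r \<subseteq> set xs \<inter> conn ?T r" using conn_mono[of ?S ?T r] T by blast
    then have "?c \<le> card (set xs \<inter> conn ?T r)" by (simp add: card_mono)
    moreover have "x \<notin> set xs" using x by simp
    ultimately show ?thesis by (simp add: Int_insert_left)
  qed
  then show ?case using steps_le_mono[OF steps_le_trans[OF 1 2]] by simp
qed

text \<open>This is the total depth of the forest with these tubes, a root having depth one.\<close>

primrec weight :: "'a list \<Rightarrow> nat" where
  "weight [] = 0"
| "weight (v # vs) = card (conn (set (v # vs)) v) + weight vs"

text \<open>The target is built from the front: its first vertex is moved there at a cost of at most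
  the size of its tube, and the rest of the order is then rearranged underneath it.\<close>

lemma tubing_steps_weight:
  assumes "distinct xs" and "distinct ys" and "set xs = set ys"
  shows "(tubing xs, tubing ys) \<in> steps_le (rotations (set ys)) (weight ys)"
  using assms
proof (induction ys arbitrary: xs)
  case Nil
  then show ?case by (simp add: steps_le_refl)
next
  case (Cons r ys)
  let ?S = "set (r # ys)"
  from Cons.prems obtain as bs where xs: "xs = as @ r # bs" by (metis list.set_intros(1) split_list)
  have "card (set as \<inter> conn ?S r) \<le> card (conn ?S r)"
    by (rule card_mono) (auto intro: finite_subset[OF conn_subset])
  with move_to_front[of as r bs]
  have 1: "(tubing xs, tubing (r # as @ bs)) \<in> steps_le (rotations ?S) (card (conn ?S r))"
    using Cons.prems(1,3) xs steps_le_mono by metis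
  have s: "set (as @ bs) = set ys" using Cons.prems xs by auto
  have "(tubing (as @ bs), tubing ys) \<in> steps_le (rotations (set ys)) (weight ys)"
    by (rule Cons.IH) (use Cons.prems xs s in auto)
  then have "(insert (conn ?S r) (tubing (as @ bs)), insert (conn ?S r) (tubing ys))
      \<in> steps_le (rotations ?S) (weight ys)"
    unfolding list.set by (rule steps_le_map[rotated]) (rule rotations_Cons, use Cons.prems in auto)
  then have 2: "(tubing (r # as @ bs), tubing (r # ys)) \<in> steps_le (rotations ?S) (weight ys)"
    using s by simp
  show ?case using steps_le_trans[OF 1 2] by simp
qed

end

section \<open>Search trees as tubings\<close>

lemma tubes_Node: "tubes (Node r Ts) = insert (set_rtree (Node r Ts)) (\<Union>T \<in> fset Ts. tubes T)"
  by (auto simp: tubes_def)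

lemma set_rtree_in_tubes: "set_rtree T \<in> tubes T"
  by (cases T) (simp add: tubes_Node)

lemma tubes_subset: "x \<in> tubes T \<Longrightarrow> x \<noteq> {} \<and> x \<subseteq> set_rtree T"
proof (induction T)
  case (Node r Ts)
  show ?case
  proof (cases "x = set_rtree (Node r Ts)")
    case False
    then obtain T where "T \<in> fset Ts" "x \<in> tubes T" using Node.prems by (auto simp: tubes_Node)
    then have "x \<noteq> {}" "x \<subseteq> set_rtree T" using Node.IH by auto
    then show ?thesis using \<open>T \<in> fset Ts\<close> by auto
  qed simp
qed

section \<open>Induced subgraphs and their components\<close>

context sym_relation
begin

text \<open>Cutting \<open>E\<close> down to \<open>S\<close> makes this a well-formed graph for
  every \<open>S\<close>, in the record type on which \<open>search_tree\<close> recurses.\<close>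

definition gr :: "'a set \<Rightarrow> ('a, 'a \<times> 'a) pre_digraph" where
  "gr S = with_proj \<lparr> pverts = S, parcs = E \<inter> S \<times> S \<rparr>"

definition parts :: "'a set \<Rightarrow> 'a set set" where
  "parts S = conn S ` S"

lemma conn_in_parts: "v \<in> S \<Longrightarrow> conn S v \<in> parts S"
  by (simp add: parts_def)

lemma parts_subset: "C \<in> parts S \<Longrightarrow> C \<subseteq> S"
  using conn_subset by (auto simp: parts_def)

lemma finite_parts: "finite S \<Longrightarrow> finite (parts S)"
  by (simp add: parts_def)

lemma part_eq_conn: "C \<in> parts S \<Longrightarrow> v \<in> C \<Longrightarrow> C = conn S v"
  using conn_eq by (auto simp: parts_def)

lemma Union_parts: "\<Union> (parts S) = S"
proof
  show "\<Union> (parts S) \<subseteq> S" by (intro Union_least) (rule parts_subset)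
  show "S \<subseteq> \<Union> (parts S)" using conn_self conn_in_parts by (meson UnionI subsetI)
qed

definition connected_set :: "'a set \<Rightarrow> bool" where
  "connected_set S \<longleftrightarrow> S \<noteq> {} \<and> (\<forall>v \<in> S. conn S v = S)"

lemma gr_simps [simp]:
  "verts (gr S) = S" "arcs (gr S) = E \<inter> S \<times> S" "tail (gr S) = fst" "head (gr S) = snd"
  by (simp_all add: gr_def)

lemma wf_gr: "wf_digraph (gr S)"
  by unfold_locales auto

lemma reachable_gr: "u \<rightarrow>\<^sup>*\<^bsub>gr S\<^esub> v \<longleftrightarrow> v \<in> conn S u"
proof -
  have "(u, v) \<in> rtrancl_on S (E \<inter> S \<times> S)" if "(u, v) \<in> rtrancl_on S E"
    using that by (induction rule: rtrancl_on_induct) (auto intro: rtrancl_on_into_rtrancl_on)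
  moreover have "(u, v) \<in> rtrancl_on S E" if "(u, v) \<in> rtrancl_on S (E \<inter> S \<times> S)"
    using that by (rule rtrancl_on_mono[rotated 2]) auto
  ultimately show ?thesis
    by (auto simp: reachable_def conn_def gr_def)
qed

lemma strongly_connected_gr: "strongly_connected (gr S) \<longleftrightarrow> connected_set S"
proof -
  have "(\<forall>v \<in> S. u \<rightarrow>\<^sup>*\<^bsub>gr S\<^esub> v) \<longleftrightarrow> conn S u = S" for u
    using conn_subset[of S u] unfolding reachable_gr by auto
  then show ?thesis by (simp add: strongly_connected_def connected_set_def)
qed

text \<open>Maximality among strongly connected induced subgraphs thereby becomes maximality among
  connected vertex sets.\<close>

lemma induced_subgraph_gr: "induced_subgraph H (gr S) \<longleftrightarrow> (\<exists>K \<subseteq> S. H = gr K)"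
proof
  assume H: "induced_subgraph H (gr S)"
  then have "verts H \<subseteq> S" "arcs H = E \<inter> verts H \<times> verts H" "tail H = fst" "head H = snd"
    by (auto simp: induced_subgraph_def subgraph_def compatible_def)
  then show "\<exists>K \<subseteq> S. H = gr K"
    by (intro exI[of _ "verts H"]) (auto intro!: pre_digraph.equality)
next
  assume "\<exists>K \<subseteq> S. H = gr K"
  then show "induced_subgraph H (gr S)"
    by (auto simp: induced_subgraph_def subgraph_def compatible_def wf_gr)
qed

lemma connected_set_parts:
  assumes "C \<in> parts S"
  shows "connected_set C"
proof -
  obtain v where v: "v \<in> S" "C = conn S v" using assms by (auto simp: parts_def)
  have "conn C u = C" if "u \<in> C" for u
  proof -
    have "conn S u = C" using that v conn_eq by simp
    then show ?thesis using conn_restrict[of S u C] conn_subset v by auto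
  qed
  then show ?thesis using v conn_self[OF v(1)] unfolding connected_set_def by auto
qed

lemma connected_set_subset_conn: "connected_set K \<Longrightarrow> K \<subseteq> S \<Longrightarrow> v \<in> K \<Longrightarrow> K \<subseteq> conn S v"
  using conn_mono unfolding connected_set_def by blast

text \<open>Parts are the maximal connected vertex sets, because every connected set through a
  vertex lies in the component of that vertex.\<close>

lemma components_gr: "components (gr S) = gr ` parts S"
proof -
  have max: "K \<in> parts S \<longleftrightarrow> K \<subseteq> S \<and> connected_set K \<and> \<not> (\<exists>K' \<subseteq> S. connected_set K' \<and> K \<subset> K')" for K
  proof
    assume K: "K \<in> parts S"
    then obtain v where v: "v \<in> S" "K = conn S v" by (auto simp: parts_def)
    have "K' \<subseteq> K" if "K' \<subseteq> S" "connected_set K'" "K \<subset> K'" for K'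
    proof -
      have "v \<in> K'" using that(3) v conn_self[OF v(1)] by blast
      then show ?thesis using connected_set_subset_conn[OF that(2,1)] v(2) by simp
    qed
    then have "\<not> (\<exists>K' \<subseteq> S. connected_set K' \<and> K \<subset> K')" by blast
    moreover have "K \<subseteq> S" using v(2) conn_subset by simp
    ultimately show "K \<subseteq> S \<and> connected_set K \<and> \<not> (\<exists>K' \<subseteq> S. connected_set K' \<and> K \<subset> K')"
      using connected_set_parts[OF K] by blast
  next
    assume K: "K \<subseteq> S \<and> connected_set K \<and> \<not> (\<exists>K' \<subseteq> S. connected_set K' \<and> K \<subset> K')"
    then obtain v where v: "v \<in> K" unfolding connected_set_def by auto
    then have v': "K \<subseteq> conn S v" "conn S v \<in> parts S"
      using K connected_set_subset_conn[of K S v] conn_in_parts[of v S] by auto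
    then have "\<not> K \<subset> conn S v" using K connected_set_parts[OF v'(2)] conn_subset[of S v] by blast
    then show "K \<in> parts S" using v' by auto
  qed
  have "components (gr S) = {gr K | K. K \<subseteq> S \<and> connected_set K \<and> \<not> (\<exists>K' \<subseteq> S. connected_set K' \<and> K \<subset> K')}"
  proof -
    have *: "(\<exists>H'. (\<exists>K' \<subseteq> S. H' = gr K') \<and> strongly_connected H' \<and> verts (gr K) \<subset> verts H') \<longleftrightarrow>
        (\<exists>K' \<subseteq> S. connected_set K' \<and> K \<subset> K')" for K
      by (metis gr_simps(1) strongly_connected_gr)
    have "components (gr S) = {gr K | K. K \<subseteq> S \<and> strongly_connected (gr K) \<and>
        \<not> (\<exists>H'. (\<exists>K' \<subseteq> S. H' = gr K') \<and> strongly_connected H' \<and> verts (gr K) \<subset> verts H')}"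
      unfolding components_def pre_digraph.sccs_def induced_subgraph_gr by blast
    then show ?thesis unfolding * strongly_connected_gr .
  qed
  also have "\<dots> = {gr K | K. K \<in> parts S}" unfolding max ..
  finally show ?thesis by (simp add: Setcompr_eq_image)
qed

lemma del_vert_gr: "pre_digraph.del_vert (gr S) r = gr (S - {r})"
  by (rule pre_digraph.equality) (auto simp: pre_digraph.del_vert_def)

section \<open>Correspondence of search trees and tubings\<close>

lemma parts_disjoint:
  assumes "C \<in> parts S" "D \<in> parts S" "u \<in> C" "w \<in> D" "(u, w) \<in> E \<or> u = w"
  shows "C = D"
proof -
  have "w \<in> S" using assms(2,4) parts_subset by blast
  then have "w \<in> C" using assms(3,5) conn_step part_eq_conn[OF assms(1,3)] by auto
  then show ?thesis using part_eq_conn[OF assms(1)] part_eq_conn[OF assms(2,4)] by simp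
qed

text \<open>Subtrees are indexed by vertex sets here and by graphs in \<open>search_tree\<close>;
  \<open>gr\<close> and \<open>verts\<close> translate between the two.\<close>

lemma search_tree_gr_Node:
  "search_tree (gr S) (Node r Ts) \<longleftrightarrow>
    r \<in> S \<and> (\<exists>t. (\<forall>C \<in> parts (S - {r}). search_tree (gr C) (t C)) \<and> fset Ts = t ` parts (S - {r}))"
  (is "?L \<longleftrightarrow> ?R")
proof
  assume ?L
  then obtain t where t: "r \<in> S" "\<And>C. C \<in> components (gr (S - {r})) \<Longrightarrow> search_tree C (t C)"
      "fset Ts = t ` components (gr (S - {r}))"
    by cases (auto simp: del_vert_gr)
  then show ?R
    by (intro conjI exI[of _ "t \<circ> gr"]) (auto simp: components_gr image_image)
next
  assume R: ?R
  then obtain t where t: "\<forall>C \<in> parts (S - {r}). search_tree (gr C) (t C)" "fset Ts = t ` parts (S - {r})"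
    by (elim conjE exE) (rule that)
  show ?L
    by (rule search_tree.intros[where t = "t \<circ> verts"])
      (use R t in \<open>auto simp: del_vert_gr components_gr image_image\<close>)
qed

lemma search_tree_gr_NodeE:
  assumes "search_tree (gr S) (Node r Ts)"
  obtains t where "r \<in> S" "\<forall>C \<in> parts (S - {r}). search_tree (gr C) (t C)"
    "fset Ts = t ` parts (S - {r})"
proof -
  obtain t where "r \<in> S" "\<forall>C \<in> parts (S - {r}). search_tree (gr C) (t C)" "fset Ts = t ` parts (S - {r})"
    using iffD1[OF search_tree_gr_Node assms] by blast
  then show ?thesis using that[of t] by blast
qed

lemma set_rtree_search_tree: "search_tree (gr S) T \<Longrightarrow> set_rtree T = S"
proof (induction T arbitrary: S)
  case (Node r Ts)
  from Node.prems obtain t where t: "r \<in> S"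
      "\<forall>C \<in> parts (S - {r}). search_tree (gr C) (t C)" "fset Ts = t ` parts (S - {r})"
    by (rule search_tree_gr_NodeE)
  have *: "set_rtree (t C) = C" if "C \<in> parts (S - {r})" for C
    using Node.IH[of "t C" C] t that by auto
  then have "(\<Union>T \<in> fset Ts. set_rtree T) = S - {r}"
    using Union_parts[of "S - {r}"] unfolding t(3) by simp
  then show ?case using t(1) by auto
qed

lemma tubes_search_tree:
  assumes "r \<in> S" "\<forall>C \<in> parts (S - {r}). search_tree (gr C) (t C)" "fset Ts = t ` parts (S - {r})"
  shows "tubes (Node r Ts) = insert S (\<Union>C \<in> parts (S - {r}). tubes (t C))"
proof -
  have "search_tree (gr S) (Node r Ts)"
    unfolding search_tree_gr_Node using assms by (intro conjI exI[of _ t]) simp_all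
  then have "set_rtree (Node r Ts) = S" by (rule set_rtree_search_tree)
  then show ?thesis unfolding tubes_Node assms(3) by blast
qed

text \<open>Different members are disjoint and have no edges between them, so their orders can be
  concatenated in any sequence. This is applied to the subtrees below a root.\<close>

lemma tubing_concat:
  assumes "finite \<F>" and "\<And>C. C \<in> \<F> \<Longrightarrow> distinct (f C) \<and> set (f C) = C"
    and "\<And>C D u w. C \<in> \<F> \<Longrightarrow> D \<in> \<F> \<Longrightarrow> u \<in> C \<Longrightarrow> w \<in> D \<Longrightarrow> (u, w) \<in> E \<or> u = w \<Longrightarrow> C = D"
  shows "\<exists>xs. distinct xs \<and> set xs = \<Union> \<F> \<and> tubing xs = (\<Union>C \<in> \<F>. tubing (f C))"
  using assms
proof (induction \<F>)
  case (insert C \<F>)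
  have "\<exists>xs. distinct xs \<and> set xs = \<Union> \<F> \<and> tubing xs = (\<Union>C \<in> \<F>. tubing (f C))"
    by (rule insert.IH) (use insert.prems in blast)+
  then obtain xs where xs: "distinct xs" "set xs = \<Union> \<F>" "tubing xs = (\<Union>C \<in> \<F>. tubing (f C))"
    by blast
  have C: "distinct (f C)" "set (f C) = C" using insert.prems(1) by auto
  have *: "(u, w) \<notin> E \<and> u \<noteq> w" if "u \<in> C" "w \<in> \<Union> \<F>" for u w
    using that insert.hyps(2) insert.prems(2)[of C _ u w] by blast
  have "tubing (f C @ xs) = (\<Union>C \<in> insert C \<F>. tubing (f C))"
    using tubing_append[of "f C" xs] * C xs by simp
  moreover have "distinct (f C @ xs)" using * C xs by auto
  moreover have "set (f C @ xs) = \<Union> (insert C \<F>)" using C xs by simp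
  ultimately show ?case by blast
qed (auto intro: exI[of _ "[]"])

text \<open>The order lists the root first and then the orders of the subtrees one after another.
  Connectedness makes the first tube all of \<open>S\<close>.\<close>

lemma tubing_of_search_tree:
  assumes "search_tree (gr S) T" "finite S" "connected_set S"
  shows "\<exists>xs. distinct xs \<and> set xs = S \<and> tubing xs = tubes T"
  using assms
proof (induction T arbitrary: S rule: rtree.induct)
  case (Node r Ts)
  let ?P = "parts (S - {r})"
  from Node.prems(1) obtain t where t: "r \<in> S"
      "\<forall>C \<in> ?P. search_tree (gr C) (t C)" "fset Ts = t ` ?P"
    by (rule search_tree_gr_NodeE)
  have "\<exists>xs. distinct xs \<and> set xs = C \<and> tubing xs = tubes (t C)" if C: "C \<in> ?P" for C
  proof (rule Node.IH)
    show "finite C" using parts_subset[OF C] Node.prems(2) by (meson finite_Diff finite_subset)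
  qed (use t C connected_set_parts[OF C] in auto)
  then obtain f where f: "\<And>C. C \<in> ?P \<Longrightarrow> distinct (f C) \<and> set (f C) = C \<and> tubing (f C) = tubes (t C)"
    by metis
  obtain xs where xs: "distinct xs" "set xs = \<Union> ?P" "tubing xs = (\<Union>C \<in> ?P. tubing (f C))"
  proof -
    have "\<exists>xs. distinct xs \<and> set xs = \<Union> ?P \<and> tubing xs = (\<Union>C \<in> ?P. tubing (f C))"
    proof (rule tubing_concat)
      show "finite ?P" using Node.prems(2) by (simp add: finite_parts)
      show "distinct (f C) \<and> set (f C) = C" if "C \<in> ?P" for C using f[OF that] by simp
    qed (rule parts_disjoint)
    then show ?thesis using that by blast
  qed
  have S: "set (r # xs) = S" using xs(2) Union_parts[of "S - {r}"] t(1) by auto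
  have "tubing (r # xs) = insert S (\<Union>C \<in> ?P. tubes (t C))"
    using S xs(3) f Node.prems(3) t(1) unfolding connected_set_def by auto
  also have "\<dots> = tubes (Node r Ts)" using tubes_search_tree[of r S t Ts, OF t] by simp
  finally show ?case using S xs(1,2) Union_parts[of "S - {r}"] by (intro exI[of _ "r # xs"]) auto
qed

text \<open>The first vertex becomes the root, and each remaining component takes the order filtered
  to it. The filtered lists need not be suffixes, hence the induction on length.\<close>

lemma search_tree_of_tubing:
  assumes "distinct xs" "connected_set (set xs)"
  shows "\<exists>T. search_tree (gr (set xs)) T \<and> tubes T = tubing xs"
  using assms
proof (induction xs rule: length_induct)
  case (1 xs)
  then obtain r ys where xs: "xs = r # ys" unfolding connected_set_def by (cases xs) auto
  let ?S = "set xs" and ?P = "parts (set ys)"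
  have S: "?S - {r} = set ys" "r \<in> ?S" using 1 xs by auto
  have filt: "set (filter (\<lambda>v. v \<in> C) ys) = C" if "C \<in> ?P" for C
    using parts_subset[OF that] by auto
  have "\<exists>T. search_tree (gr C) T \<and> tubes T = tubing (filter (\<lambda>v. v \<in> C) ys)" if C: "C \<in> ?P" for C
  proof -
    have "length (filter (\<lambda>v. v \<in> C) ys) < length xs" by (simp add: xs le_imp_less_Suc)
    moreover have "distinct (filter (\<lambda>v. v \<in> C) ys)" using 1 xs by simp
    moreover have "connected_set (set (filter (\<lambda>v. v \<in> C) ys))"
      unfolding filt[OF C] by (rule connected_set_parts[OF C])
    ultimately show ?thesis using 1(1) filt[OF C] by metis
  qed
  then obtain t where t: "\<forall>C \<in> ?P. search_tree (gr C) (t C)"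
      "\<And>C. C \<in> ?P \<Longrightarrow> tubes (t C) = tubing (filter (\<lambda>v. v \<in> C) ys)" by metis
  obtain Ts where Ts: "fset Ts = t ` ?P" using Abs_fset_inverse[of "t ` ?P"] finite_parts by auto
  have T: "search_tree (gr ?S) (Node r Ts)" 
    unfolding search_tree_gr_Node S(1) using S(2) t(1) Ts by (intro conjI exI[of _ t]) simp_all
  have "tubing (filter (\<lambda>v. v \<in> C) ys) = {x \<in> tubing ys. x \<subseteq> C}" if "C \<in> ?P" for C
  proof (rule tubing_filter)
    fix u w assume "u \<in> C" "w \<in> set ys" "(u, w) \<in> E"
    then show "w \<in> C" using conn_step[of u "set ys" u w] part_eq_conn[OF that, of u] by simp
  qed
  then have "(\<Union>C \<in> ?P. tubes (t C)) = (\<Union>C \<in> ?P. {x \<in> tubing ys. x \<subseteq> C})" using t(2) by simp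
  also have "\<dots> = tubing ys" using tubing_connected[of _ ys] conn_in_parts[of _ "set ys"] by blast
  finally have "tubes (Node r Ts) = tubing xs"
    using tubes_search_tree[of r ?S t Ts] S t(1) Ts 1(3) xs unfolding connected_set_def by simp
  then show ?case using T by blast
qed

text \<open>The root is the one vertex that no tube other than \<open>S\<close> contains, and the
  tubes inside a component of the rest are those of one subtree. So a tree is recovered recursively
  from its tubes.\<close>

lemma search_tree_eqI:
  assumes "search_tree (gr S) T" "search_tree (gr S) T'" "tubes T = tubes T'"
  shows "T = T'"
  using assms
proof (induction T arbitrary: S T' rule: rtree.induct)
  case (Node r Ts)
  obtain r' Ts' where T': "T' = Node r' Ts'" by (cases T')
  from Node.prems(1) obtain t where t: "r \<in> S"
      "\<forall>C \<in> parts (S - {r}). search_tree (gr C) (t C)" "fset Ts = t ` parts (S - {r})"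
    by (rule search_tree_gr_NodeE)
  from Node.prems(2) obtain t' where t': "r' \<in> S"
      "\<forall>C \<in> parts (S - {r'}). search_tree (gr C) (t' C)" "fset Ts' = t' ` parts (S - {r'})"
    unfolding T' by (rule search_tree_gr_NodeE)
  have sub: "x \<noteq> {} \<and> x \<subseteq> C" if "search_tree (gr C) U" "x \<in> tubes U" for x C U
    using tubes_subset[OF that(2)] set_rtree_search_tree[OF that(1)] by simp
  have Un: "\<Union> (tubes (Node q Us) - {S}) = S - {q}"
    if q: "q \<in> S" and u: "\<forall>C \<in> parts (S - {q}). search_tree (gr C) (u C)"
      and Us: "fset Us = u ` parts (S - {q})" for q Us u
  proof -
    have 1: "x \<subseteq> S - {q}" if "x \<in> tubes (u C)" "C \<in> parts (S - {q})" for x C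
    proof -
      have "x \<subseteq> C" using sub[OF bspec[OF u that(2)] that(1)] by simp
      also have "C \<subseteq> S - {q}" by (rule parts_subset[OF that(2)])
      finally show ?thesis .
    qed
    have "C \<in> tubes (u C)" if "C \<in> parts (S - {q})" for C
      using set_rtree_in_tubes[of "u C"] set_rtree_search_tree[OF bspec[OF u that]] by simp
    then have 2: "\<Union> (parts (S - {q})) \<subseteq> \<Union> (\<Union>C \<in> parts (S - {q}). tubes (u C))" by blast
    have "tubes (Node q Us) - {S} = (\<Union>C \<in> parts (S - {q}). tubes (u C))"
    proof -
      have "S \<notin> tubes (u C)" if "C \<in> parts (S - {q})" for C using 1[of S C] that q by blast
      then have "S \<notin> (\<Union>C \<in> parts (S - {q}). tubes (u C))" by (simp only: UN_iff) blast
      then show ?thesis unfolding tubes_search_tree[of q S u Us, OF q u Us] by (rule Diff_insert_absorb)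
    qed
    moreover have "\<Union> (\<Union>C \<in> parts (S - {q}). tubes (u C)) \<subseteq> S - {q}"
      by (intro Union_least, elim UN_E) (rule 1)
    ultimately show ?thesis using 2 unfolding Union_parts by simp
  qed
  from Un[OF t] Un[OF t'] have "S - {r} = S - {r'}" using Node.prems(3) T' by simp
  then have r: "r' = r" using t(1) t'(1) by blast
  let ?P = "parts (S - {r})"
  have part: "{x \<in> tubes (Node r Us). x \<subseteq> C} = tubes (u C)"
    if C: "C \<in> ?P" and u: "\<forall>C \<in> ?P. search_tree (gr C) (u C)" "fset Us = u ` ?P" for C u Us
  proof -
    have 1: "C = D" if D: "x \<in> tubes (u D)" "D \<in> ?P" "x \<subseteq> C" for x D
    proof -
      have "x \<noteq> {} \<and> x \<subseteq> D" by (rule sub[OF bspec[OF u(1) D(2)] D(1)])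
      then obtain w where "w \<in> x" "w \<in> D" by blast
      then show ?thesis using parts_disjoint[OF C D(2), of w w] D(3) by blast
    qed
    have 2: "\<not> S \<subseteq> C" using t(1) parts_subset[OF C] by blast
    have 3: "x \<subseteq> C" if "x \<in> tubes (u C)" for x using sub[OF bspec[OF u(1) C] that] by simp
    show ?thesis
      unfolding tubes_search_tree[of r S u Us, OF t(1) u]
    proof (intro equalityI subsetI)
      fix x assume "x \<in> {x \<in> insert S (\<Union>C \<in> ?P. tubes (u C)). x \<subseteq> C}"
      then obtain D where "D \<in> ?P" "x \<in> tubes (u D)" "x \<subseteq> C" using 2 by auto
      then show "x \<in> tubes (u C)" using 1 by blast
    next
      fix x assume "x \<in> tubes (u C)"
      then show "x \<in> {x \<in> insert S (\<Union>C \<in> ?P. tubes (u C)). x \<subseteq> C}" using C 3 by blast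
    qed
  qed
  have "t C = t' C" if C: "C \<in> ?P" for C
  proof (rule Node.IH)
    show "t C \<in> fset Ts" using t(3) C by simp
    show "search_tree (gr C) (t C)" "search_tree (gr C) (t' C)" using t(2) t'(2) C r by auto
    have "{x \<in> tubes (Node r Ts). x \<subseteq> C} = tubes (t C)" by (rule part[OF C t(2,3)])
    moreover have "{x \<in> tubes (Node r Ts'). x \<subseteq> C} = tubes (t' C)"
      by (rule part[OF C]) (use t'(2,3) r in auto)
    ultimately show "tubes (t C) = tubes (t' C)" using Node.prems(3) T' r by simp
  qed
  then have "fset Ts = fset Ts'" using t(3) t'(3) r by auto
  then show ?case using T' r by (simp add: fset_inject)
qed

section \<open>Walks of search trees and of tubings\<close>

lemma arcs_ends_rotation_graph:
  "arcs_ends (with_proj (rotation_graph (gr S))) =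
    {(T, U). search_tree (gr S) T \<and> search_tree (gr S) U \<and> card (sym_diff (tubes T) (tubes U)) = 2}"
  by (simp add: rotation_graph_def)

lemma relpow_rotations_tubes:
  assumes "finite S" "connected_set S" "(T, U) \<in> arcs_ends (with_proj (rotation_graph (gr S))) ^^ j"
  shows "(tubes T, tubes U) \<in> rotations S ^^ j"
  using assms(3)
proof (induction j arbitrary: U)
  case (Suc j)
  from Suc.prems obtain V where VU: "(T, V) \<in> arcs_ends (with_proj (rotation_graph (gr S))) ^^ j"
    "(V, U) \<in> arcs_ends (with_proj (rotation_graph (gr S)))"
    by (rule relpow_Suc_E)
  then have V: "search_tree (gr S) V" "search_tree (gr S) U" "card (sym_diff (tubes V) (tubes U)) = 2"
    unfolding arcs_ends_rotation_graph by auto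
  obtain xs ys where "distinct xs" "set xs = S" "tubing xs = tubes V"
      "distinct ys" "set ys = S" "tubing ys = tubes U"
    using tubing_of_search_tree[OF V(1) assms(1,2)] tubing_of_search_tree[OF V(2) assms(1,2)] by blast
  then have "(tubes V, tubes U) \<in> rotations S" using rotationsI V(3) by metis
  then show ?case using Suc.IH[OF VU(1)] by auto
qed simp

text \<open>Every intermediate tubing is lifted to a tree; that tubes determine the tree settles the
  walk of length zero.\<close>

lemma relpow_tubes_rotations:
  assumes "connected_set S" "search_tree (gr S) T" "search_tree (gr S) U"
    and "(tubes T, tubes U) \<in> rotations S ^^ j"
  shows "(T, U) \<in> arcs_ends (with_proj (rotation_graph (gr S))) ^^ j"
  using assms(3,4)
proof (induction j arbitrary: U)
  case 0
  then show ?case using search_tree_eqI[OF assms(2)] by auto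
next
  case (Suc j)
  then obtain M where M: "(tubes T, M) \<in> rotations S ^^ j" "(M, tubes U) \<in> rotations S" by auto
  from M(2) obtain xs where xs: "distinct xs" "set xs = S" "M = tubing xs" "card (sym_diff M (tubes U)) = 2"
    by (rule rotationsE)
  then obtain V where V: "search_tree (gr S) V" "tubes V = M"
    using search_tree_of_tubing[of xs] assms(1) by auto
  then have "(T, V) \<in> arcs_ends (with_proj (rotation_graph (gr S))) ^^ j" using Suc.IH M by simp
  moreover have "(V, U) \<in> arcs_ends (with_proj (rotation_graph (gr S)))"
    using V xs Suc.prems unfolding arcs_ends_rotation_graph by simp
  ultimately show ?case by (rule relpow_Suc_I)
qed


section \<open>Each rotation reverses at most one edge\<close>

text \<open>Indexes tubes by their top vertices; the value is empty for a vertex outside the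
  list.\<close>

primrec tube :: "'a list \<Rightarrow> 'a \<Rightarrow> 'a set" where
  "tube [] v = {}"
| "tube (x # xs) v = (if v = x then conn (set (x # xs)) x else tube xs v)"

lemma tube_in_tubing: "v \<in> set xs \<Longrightarrow> tube xs v \<in> tubing xs"
  by (induction xs) auto

lemma tube_self: "v \<in> set xs \<Longrightarrow> v \<in> tube xs v"
  by (induction xs) (auto simp: conn_self)

lemma tube_subset: "tube xs v \<subseteq> set xs"
proof (induction xs)
  case (Cons x xs)
  then show ?case using conn_subset[of "set (x # xs)" x] by auto
qed simp

text \<open>An earlier tube contains its top vertex, which no later tube does.\<close>

lemma tube_inj:
  "distinct xs \<Longrightarrow> u \<in> set xs \<Longrightarrow> v \<in> set xs \<Longrightarrow> tube xs u = tube xs v \<Longrightarrow> u = v"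
proof (induction xs)
  case (Cons x xs)
  have x: "x \<in> conn (set (x # xs)) x" by (simp add: conn_self)
  have "x \<notin> tube xs w" for w using Cons.prems(1) tube_subset[of xs w] by auto
  with x have "conn (set (x # xs)) x \<noteq> tube xs w" for w by metis
  then show ?case using Cons by (auto split: if_splits)
qed simp

lemma tube_sorted_wrt:
  "sorted_wrt R xs \<Longrightarrow> v \<in> set xs \<Longrightarrow> u \<in> tube xs v \<Longrightarrow> u = v \<or> R v u"
proof (induction xs)
  case (Cons x xs)
  then show ?case using conn_subset[of "set (x # xs)" x] by (auto split: if_splits)
qed simp

text \<open>The endpoint that comes first is the one above: a tube containing it is contributed by a
  vertex at or before it, so the suffix holds the whole edge, while the tube of the other endpoint
  misses it.\<close>

lemma tubing_edge:
  assumes "distinct xs" "(u, v) \<in> E" "u \<noteq> v" "u \<in> set xs" "v \<in> set xs"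
  shows "u \<notin> tube xs v \<and> (\<forall>t \<in> tubing xs. u \<in> t \<longrightarrow> v \<in> t) \<or>
    v \<notin> tube xs u \<and> (\<forall>t \<in> tubing xs. v \<in> t \<longrightarrow> u \<in> t)"
  using assms
proof (induction xs)
  case (Cons x xs)
  let ?t = "conn (set (x # xs)) x"
  have vu: "(v, u) \<in> E" using Cons.prems(2) sym_E by (auto dest: symD)
  have t: "u \<in> ?t \<longleftrightarrow> v \<in> ?t"
    using conn_step[of u "set (x # xs)" x v] conn_step[of v "set (x # xs)" x u] Cons.prems vu by blast
  have out: "x \<notin> t" if "t \<in> tubing xs" for t using Cons.prems(1) tubing_subset[OF that] by auto
  have out': "x \<notin> tube xs w" for w using Cons.prems(1) tube_subset[of xs w] by auto
  show ?case
  proof (cases "u = x \<or> v = x")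
    case True
    then show ?thesis using t out out' Cons.prems(3) by auto
  next
    case False
    then have "u \<notin> tube xs v \<and> (\<forall>t \<in> tubing xs. u \<in> t \<longrightarrow> v \<in> t) \<or>
        v \<notin> tube xs u \<and> (\<forall>t \<in> tubing xs. v \<in> t \<longrightarrow> u \<in> t)"
      using Cons by auto
    then show ?thesis using t False by auto
  qed
qed simp

text \<open>A pair \<open>(u, v)\<close> in the orientation is an edge with \<open>u\<close> above \<open>v\<close> in the tree with tubes \<open>N\<close>.\<close>

definition orientation :: "'a set \<Rightarrow> 'a set set \<Rightarrow> 'a rel" where
  "orientation S N = {(u, v) \<in> E \<inter> S \<times> S. \<exists>t \<in> N. v \<in> t \<and> u \<notin> t}"

lemma finite_orientation: "finite S \<Longrightarrow> finite (orientation S N)"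
  by (rule finite_subset[of _ "S \<times> S"]) (auto simp: orientation_def)

lemma orientation_tubingD:
  assumes "distinct xs" "set xs = S" "(u, v) \<in> orientation S (tubing xs)"
  shows "u \<notin> tube xs v" and "(v, u) \<notin> orientation S (tubing xs)"
proof -
  have uv: "(u, v) \<in> E" "u \<in> set xs" "v \<in> set xs" "u \<noteq> v"
      "\<not> (\<forall>t \<in> tubing xs. v \<in> t \<longrightarrow> u \<in> t)"
    using assms(2,3) by (auto simp: orientation_def)
  with tubing_edge[OF assms(1) uv(1,4,2,3)]
  have "u \<notin> tube xs v \<and> (\<forall>t \<in> tubing xs. u \<in> t \<longrightarrow> v \<in> t)" by argo
  then show "u \<notin> tube xs v" "(v, u) \<notin> orientation S (tubing xs)"
    by (auto simp: orientation_def)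
qed

lemma orientation_total:
  assumes "distinct xs" "set xs = S" "(u, v) \<in> E \<inter> S \<times> S" "u \<noteq> v"
  shows "(u, v) \<in> orientation S (tubing xs) \<or> (v, u) \<in> orientation S (tubing xs)"
proof -
  have uv: "(u, v) \<in> E" "(v, u) \<in> E" "u \<in> set xs" "v \<in> set xs"
    using assms(2,3) sym_E by (auto dest: symD)
  have "v \<in> tube xs v" "u \<in> tube xs u" "tube xs v \<in> tubing xs" "tube xs u \<in> tubing xs"
    using uv tube_self tube_in_tubing by auto
  then show ?thesis
    using tubing_edge[OF assms(1) uv(1) assms(4) uv(3,4)] uv assms(2) unfolding orientation_def by blast
qed

text \<open>When the edge from \<open>u\<close> down to \<open>v\<close> is reversed, the tube of
  \<open>v\<close> is lost and the tube of \<open>u\<close> is gained. A rotation exchanges only two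
  tubes, so one on each side, and these determine \<open>v\<close> and \<open>u\<close>.\<close>

lemma card_orientation_rotation:
  assumes "(M, N) \<in> rotations S"
  shows "card (orientation S M - orientation S N) \<le> 1"
proof -
  from assms obtain xs ys where xy: "M = tubing xs" "N = tubing ys" "distinct xs" "distinct ys"
    "set xs = S" "set ys = S" "card (sym_diff M N) = 2"
    by (rule rotationsE)
  have flip: "tube xs v \<in> M - N \<and> tube ys u \<in> N - M \<and> u \<in> S \<and> v \<in> S"
    if uv: "(u, v) \<in> orientation S M - orientation S N" for u v
  proof -
    have S: "(u, v) \<in> E \<inter> S \<times> S" "u \<noteq> v" using uv by (auto simp: orientation_def)
    have vu: "(v, u) \<in> orientation S N" using orientation_total[OF xy(4,6) S] uv xy(2) by blast
    have a: "u \<notin> tube xs v" "(v, u) \<notin> orientation S M"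
      using orientation_tubingD[OF xy(3,5), of u v] uv xy(1) by auto
    have b: "v \<notin> tube ys u" using orientation_tubingD(1)[OF xy(4,6)] vu xy(2) by auto
    have "v \<in> tube xs v" "tube xs v \<in> M" "u \<in> tube ys u" "tube ys u \<in> N"
      using S xy tube_self tube_in_tubing by auto
    moreover have "t \<notin> N" if "v \<in> t" "u \<notin> t" for t using that uv S by (auto simp: orientation_def)
    moreover have "(v, u) \<in> E" using S sym_E by (auto dest: symD)
    then have "t \<notin> M" if "u \<in> t" "v \<notin> t" for t using that a(2) S by (auto simp: orientation_def)
    ultimately show ?thesis using a(1) b S by auto
  qed
  have fin: "finite M" "finite N" using xy finite_tubing by auto
  have sum: "card (M - N) + card (N - M) = 2"
    using xy(7) fin by (subst (asm) card_Un_disjoint) auto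
  have "p = q" if pq: "p \<in> orientation S M - orientation S N" "q \<in> orientation S M - orientation S N" for p q
  proof -
    obtain u v u' v' where uv: "p = (u, v)" "q = (u', v')" by (cases p, cases q)
    have f: "tube xs v \<in> M - N \<and> tube ys u \<in> N - M \<and> u \<in> S \<and> v \<in> S"
        "tube xs v' \<in> M - N \<and> tube ys u' \<in> N - M \<and> u' \<in> S \<and> v' \<in> S"
      using flip pq uv by auto
    then have "card (M - N) > 0" "card (N - M) > 0" using fin by (auto simp: card_gt_0_iff)
    then have "card (M - N) = 1" "card (N - M) = 1" using sum by linarith+
    then have "tube xs v = tube xs v'" "tube ys u = tube ys u'" using f by (metis card_1_singletonE singletonD)+
    then show ?thesis using tube_inj xy f uv by metis
  qed
  moreover have "finite (orientation S M - orientation S N)"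
    using finite_orientation[of S M] xy(5) by auto
  ultimately show ?thesis by (simp add: card_le_Suc0_iff_eq)
qed

lemma card_orientation_relpow:
  assumes "finite S" "(M, N) \<in> rotations S ^^ k"
  shows "card (orientation S M - orientation S N) \<le> k"
  using assms(2)
proof (induction k arbitrary: N)
  case (Suc k)
  from Suc.prems obtain P where P: "(M, P) \<in> rotations S ^^ k" "(P, N) \<in> rotations S"
    by (rule relpow_Suc_E)
  let ?o = "orientation S"
  have "card (?o M - ?o N) \<le> card ((?o M - ?o P) \<union> (?o P - ?o N))"
    using finite_orientation[OF assms(1)] by (intro card_mono) auto
  also have "\<dots> \<le> card (?o M - ?o P) + card (?o P - ?o N)" by (rule card_Un_le)
  also have "\<dots> \<le> Suc k" using Suc.IH[OF P(1)] card_orientation_rotation[OF P(2)] by linarith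
  finally show ?case .
qed simp

text \<open>Passing from \<open>xs\<close> to its reverse turns every edge around, and each rotation
  turns at most one. As \<open>R\<close> is asymmetric and sorts \<open>xs\<close>, each edge is
  counted once.\<close>

lemma edges_le_rotations:
  assumes "(tubing xs, tubing (rev xs)) \<in> rotations S ^^ k" "distinct xs" "set xs = S" "sorted_wrt R xs"
    and "asymp R"
  shows "card {(u, v) \<in> E \<inter> S \<times> S. R u v} \<le> k"
proof -
  let ?o = "orientation S"
  note R = asympD[OF assms(5)]
  have "{(u, v) \<in> E \<inter> S \<times> S. R u v} \<subseteq> ?o (tubing xs) - ?o (tubing (rev xs))"
  proof clarify
    fix u v assume uv: "R u v" "(u, v) \<in> E" "u \<in> S" "v \<in> S"
    have ne: "u \<noteq> v" using R uv(1) by blast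
    have "u \<notin> tube xs v" using tube_sorted_wrt[OF assms(4), of v u] R[OF uv(1)] uv assms(3) ne by auto
    then have 1: "(u, v) \<in> ?o (tubing xs)"
      using uv tube_self[of v xs] tube_in_tubing[of v xs] assms(3) by (auto simp: orientation_def)
    have "sorted_wrt (\<lambda>x y. R y x) (rev xs)" using assms(4) by (simp add: sorted_wrt_rev)
    then have "v \<notin> tube (rev xs) u"
      using tube_sorted_wrt[of "\<lambda>x y. R y x" "rev xs" u v] R[OF uv(1)] uv assms(3) ne by auto
    moreover have "(v, u) \<in> E" using uv(2) sym_E by (auto dest: symD)
    ultimately have "(v, u) \<in> ?o (tubing (rev xs))"
      using uv tube_self[of u "rev xs"] tube_in_tubing[of u "rev xs"] assms(3)
      by (auto simp: orientation_def)
    then have "(u, v) \<notin> ?o (tubing (rev xs))"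
      using orientation_tubingD(2)[of "rev xs" S v u] assms(2,3) by auto
    then show "(u, v) \<in> ?o (tubing xs) - ?o (tubing (rev xs))" using 1 by blast
  qed
  then have "card {(u, v) \<in> E \<inter> S \<times> S. R u v} \<le> card (?o (tubing xs) - ?o (tubing (rev xs)))"
    using finite_orientation[of S] assms(3) by (intro card_mono) auto
  then show ?thesis using card_orientation_relpow[OF _ assms(1)] assms(3) by fastforce
qed

end

section \<open>Orders from separators in interval representations\<close>

text \<open>The witness is the least value of \<open>a\<close> with at least \<open>m\<close>
  elements at or below it: fewer than \<open>m\<close> precede it by minimality, and fewer than
  \<open>2 * m - m\<close> follow.\<close>

lemma median_exists:
  fixes a :: "'b \<Rightarrow> real"
  assumes "finite C" "card C < 2 * m"
  shows "\<exists>x. card {u \<in> C. a u < x} < m \<and> card {u \<in> C. x < a u} < m"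
proof (cases "card C < m")
  case True
  have "card {u \<in> C. a u < 0} \<le> card C" "card {u \<in> C. 0 < a u} \<le> card C"
    using assms(1) by (auto intro: card_mono)
  then show ?thesis using True by (intro exI[of _ 0]) auto
next
  case False
  let ?le = "\<lambda>x. {u \<in> C. a u \<le> x}"
  define A where "A = {x \<in> a ` C. m \<le> card (?le x)}"
  have "0 < m" using assms(2) by simp
  then have "C \<noteq> {}" using False by auto
  have finA: "finite A" using assms(1) by (simp add: A_def)
  have "?le (Max (a ` C)) = C" using assms(1) by auto
  then have "Max (a ` C) \<in> A" using assms(1) \<open>C \<noteq> {}\<close> False by (auto simp: A_def)
  then have Min: "Min A \<in> A" using finA by (intro Min_in) auto
  define x where "x = Min A"
  have "card {u \<in> C. a u < x} < m"
  proof (cases "{u \<in> C. a u < x} = {}")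
    case True
    then show ?thesis using \<open>0 < m\<close> by (simp only: card.empty)
  next
    case ne: False
    define L where "L = {u \<in> C. a u < x}"
    \<comment> \<open>The largest value below \<open>x\<close>: the elements at or below it are
      exactly those strictly below \<open>x\<close>.\<close>
    define y where "y = Max (a ` L)"
    have L: "finite L" "L \<noteq> {}" using ne assms(1) by (auto simp: L_def)
    have "y \<in> a ` L" unfolding y_def using L by (intro Max_in) auto
    then have y: "y \<in> a ` C" "y < x" by (auto simp: L_def)
    have "y \<notin> A" using y(2) finA unfolding x_def by (meson Min_le linorder_not_less)
    moreover have "?le y = L"
      using y(2) Max_ge[of "a ` L"] L(1) by (auto simp: L_def y_def)
    ultimately show ?thesis using y(1) by (simp add: A_def L_def)
  qed
  moreover have "card {u \<in> C. x < a u} < m"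
  proof -
    have "card C = card (?le x \<union> {u \<in> C. x < a u})" by (rule arg_cong[of _ _ card]) auto
    also have "\<dots> = card (?le x) + card {u \<in> C. x < a u}"
      using assms(1) by (intro card_Un_disjoint) auto
    finally show ?thesis using Min assms(2) by (auto simp: A_def x_def)
  qed
  ultimately show ?thesis by blast
qed

context sym_relation
begin

lemma weight_append:
  assumes "finite S" "set (xs @ ys) \<subseteq> S" "distinct xs"
  shows "weight (xs @ ys) \<le> (\<Sum>v \<in> set xs. card (conn S v)) + weight ys"
  using assms
proof (induction xs)
  case (Cons x xs)
  have "card (conn (set (x # xs @ ys)) x) \<le> card (conn S x)"
    by (rule card_mono[OF finite_subset[OF conn_subset Cons.prems(1)] conn_mono[OF Cons.prems(2)[simplified append_Cons]]])
  moreover have "weight (xs @ ys) \<le> (\<Sum>v \<in> set xs. card (conn S v)) + weight ys"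
    using Cons by simp
  ultimately show ?case using Cons.prems(3) by simp
qed simp

text \<open>One induction step puts the separators of all components first. This halves the bound on
  component sizes, so \<open>L\<close> levels suffice, and a level costs at most
  \<open>w * card S\<close> because each component contains at most \<open>w\<close> vertices of its
  separator.\<close>

lemma order_with_small_weight:
  fixes a b :: "'a \<Rightarrow> real"
  assumes "finite S"
    and "\<And>u v. u \<in> S \<Longrightarrow> v \<in> S \<Longrightarrow> (u, v) \<in> E \<Longrightarrow> u \<noteq> v \<Longrightarrow> {a u..b u} \<inter> {a v..b v} \<noteq> {}"
    and "\<And>v. v \<in> S \<Longrightarrow> a v \<le> b v"
    and "\<And>x. card {v \<in> S. a v \<le> x \<and> x \<le> b v} \<le> w"
    and "\<And>v. v \<in> S \<Longrightarrow> card (conn S v) < 2 ^ L"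
  shows "\<exists>xs. distinct xs \<and> set xs = S \<and> weight xs \<le> w * L * card S"
  using assms
proof (induction L arbitrary: S)
  case 0
  have "S = {}"
  proof (rule ccontr)
    assume "S \<noteq> {}"
    then obtain v where v: "v \<in> S" by blast
    have "conn S v \<noteq> {}" "finite (conn S v)"
      using conn_self[OF v] finite_subset[OF conn_subset 0(1)] by auto
    then show False using 0(5)[OF v] by simp
  qed
  then show ?case by (intro exI[of _ "[]"]) simp
next
  case (Suc L)
  have fin: "finite (conn S v)" for v by (rule finite_subset[OF conn_subset Suc.prems(1)])
  \<comment> \<open>The splitting point is made a function of the component, so that all its
    vertices share it.\<close>
  have "\<exists>x. \<forall>v \<in> S. C = conn S v \<longrightarrow> card {u \<in> C. a u < x} < 2 ^ L \<and> card {u \<in> C. x < a u} < 2 ^ L" for C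
  proof (cases "\<exists>v \<in> S. C = conn S v")
    case True
    then obtain v where v: "v \<in> S" "C = conn S v" by blast
    show ?thesis using median_exists[of C "2 ^ L" a] Suc.prems(5)[OF v(1)] fin v(2) by auto
  qed blast
  then obtain m where "\<forall>C. \<forall>v \<in> S. C = conn S v \<longrightarrow>
      card {u \<in> C. a u < m C} < 2 ^ L \<and> card {u \<in> C. m C < a u} < 2 ^ L"
    by metis
  then have m: "card {u \<in> conn S v. a u < m (conn S v)} < 2 ^ L"
      "card {u \<in> conn S v. m (conn S v) < a u} < 2 ^ L" if "v \<in> S" for v
    using that by auto
  define B where "B = {v \<in> S. a v \<le> m (conn S v) \<and> m (conn S v) \<le> b v}"
  have small: "card (conn (S - B) v) < 2 ^ L" if v: "v \<in> S - B" for v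
  proof -
    define C where "C = conn S v"
    have vS: "v \<in> S" using v by blast
    have C: "conn S u = C" if "u \<in> C" for u using conn_eq that unfolding C_def by simp
    have vC: "v \<in> C" using conn_self[OF vS] by (simp add: C_def)
    have sep: "b u < m C \<or> m C < a u" if "u \<in> C" "u \<in> S - B" for u
      using that C by (force simp: B_def)
    have stepC: "w \<in> C" if "u \<in> C" "w \<in> S - B" "(u, w) \<in> E" for u w
      using conn_step that unfolding C_def by blast
    \<comment> \<open>Intervals on opposite sides of the splitting point are disjoint, so no edge
      joins them and each remaining component stays on one side.\<close>
    have cross: "\<not> (b u < m C \<and> m C < a w)" if "u \<in> S" "w \<in> S" "(u, w) \<in> E \<or> (w, u) \<in> E" for u w
    proof
      assume *: "b u < m C \<and> m C < a w"
      have "(u, w) \<in> E" using that(3) sym_E by (auto dest: symD)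
      moreover have "u \<noteq> w" using * Suc.prems(3)[OF that(1)] by auto
      ultimately have "{a u..b u} \<inter> {a w..b w} \<noteq> {}" using Suc.prems(2) that by blast
      then show False using * by auto
    qed
    consider "b v < m C" | "m C < a v" using sep[OF vC v] by blast
    then show ?thesis
    proof cases
      case 1
      have "conn (S - B) v \<subseteq> {u \<in> C. b u < m C}"
      proof (rule conn_closed)
        fix u w assume u: "u \<in> {u \<in> C. b u < m C}" "u \<in> S - B" and w: "w \<in> S - B" "(u, w) \<in> E"
        have "w \<in> C" using stepC u(1) w by blast
        then show "w \<in> {u \<in> C. b u < m C}" using sep[of w] cross[of u w] u w by blast
      qed (use 1 vC in simp)
      also have "\<dots> \<subseteq> {u \<in> C. a u < m C}"
        using Suc.prems(3) conn_subset[of S v] unfolding C_def by fastforce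
      finally have "card (conn (S - B) v) \<le> card {u \<in> C. a u < m C}"
        using fin[of v] by (intro card_mono) (simp_all add: C_def)
      then show ?thesis using m(1)[OF vS] by (simp add: C_def)
    next
      case 2
      have "conn (S - B) v \<subseteq> {u \<in> C. m C < a u}"
      proof (rule conn_closed)
        fix u w assume u: "u \<in> {u \<in> C. m C < a u}" "u \<in> S - B" and w: "w \<in> S - B" "(u, w) \<in> E"
        have "w \<in> C" using stepC u(1) w by blast
        then show "w \<in> {u \<in> C. m C < a u}" using sep[of w] cross[of w u] u w by blast
      qed (use 2 vC in simp)
      then have "card (conn (S - B) v) \<le> card {u \<in> C. m C < a u}"
        using fin[of v] by (intro card_mono) (simp_all add: C_def)
      then show ?thesis using m(2)[OF vS] by (simp add: C_def)
    qed
  qed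
  have "\<exists>ys. distinct ys \<and> set ys = S - B \<and> weight ys \<le> w * L * card (S - B)"
  proof (rule Suc.IH)
    show "card {v \<in> S - B. a v \<le> x \<and> x \<le> b v} \<le> w" for x
      by (rule order_trans[OF card_mono Suc.prems(4)[of x]]) (use Suc.prems(1) in auto)
  qed (use Suc.prems small in auto)
  then obtain ys where ys: "distinct ys" "set ys = S - B" "weight ys \<le> w * L * card (S - B)" by blast
  have B: "B \<subseteq> S" "finite B" using Suc.prems(1) by (auto simp: B_def)
  obtain xs where xs: "distinct xs" "set xs = B" using finite_distinct_list[OF B(2)] by blast
  text \<open>Double counting of the pairs \<open>(v, u)\<close> with \<open>v \<in> B\<close> in the component of \<open>u\<close>.\<close>
  have "(\<Sum>v \<in> B. card (conn S v)) = (\<Sum>v \<in> B. \<Sum>u \<in> S. if u \<in> conn S v then 1 else 0)"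
  proof (rule sum.cong)
    fix v assume "v \<in> B"
    have "conn S v = {u \<in> S. u \<in> conn S v}" using conn_subset by auto
    then have "card (conn S v) = card {u \<in> S. u \<in> conn S v}" by simp
    then show "card (conn S v) = (\<Sum>u \<in> S. if u \<in> conn S v then 1 else 0)"
      using Suc.prems(1) by (simp add: sum.If_cases Int_def)
  qed simp
  also have "\<dots> = (\<Sum>u \<in> S. \<Sum>v \<in> B. if u \<in> conn S v then 1 else 0)" by (rule sum.swap)
  also have "\<dots> \<le> (\<Sum>u \<in> S. w)"
  proof (rule sum_mono)
    fix u assume "u \<in> S"
    have "(\<Sum>v \<in> B. if u \<in> conn S v then 1 else 0) = card {v \<in> B. u \<in> conn S v}"
      using B(2) by (simp add: sum.If_cases Int_def)
    \<comment> \<open>All vertices of \<open>B\<close> in the component of \<open>u\<close> have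
      intervals through the same point.\<close>
    also have "\<dots> \<le> card {v \<in> S. a v \<le> m (conn S u) \<and> m (conn S u) \<le> b v}"
      using Suc.prems(1) conn_eq by (intro card_mono) (auto simp: B_def)
    also have "\<dots> \<le> w" by (rule Suc.prems(4))
    finally show "(\<Sum>v \<in> B. if u \<in> conn S v then 1 else 0) \<le> w" .
  qed
  finally have sumB: "(\<Sum>v \<in> B. card (conn S v)) \<le> w * card S" by (simp add: mult.commute)
  have "weight (xs @ ys) \<le> (\<Sum>v \<in> B. card (conn S v)) + weight ys"
    using weight_append[of S xs ys] Suc.prems(1) xs ys B by auto
  also have "\<dots> \<le> w * card S + w * L * card S"
  proof -
    have "w * L * card (S - B) \<le> w * L * card S"
      using Suc.prems(1) by (intro mult_le_mono2 card_mono) auto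
    then show ?thesis using sumB ys(3) by linarith
  qed
  finally show ?case
    using xs ys B by (intro exI[of _ "xs @ ys"]) (auto simp: algebra_simps)
qed


section \<open>The diameter of the rotation graph\<close>

context
  fixes S :: "'a set" and B :: nat
  assumes fin: "finite S" and con: "connected_set S"
    and bound: "\<And>xs ys. distinct xs \<Longrightarrow> distinct ys \<Longrightarrow> set xs = S \<Longrightarrow> set ys = S \<Longrightarrow>
      (tubing xs, tubing ys) \<in> steps_le (rotations S) B"
begin

text \<open>The bound of the context does double duty: besides limiting the distance it shows that a
  walk exists, so that the \<open>LEAST\<close> in \<open>graph_dist\<close> is attained.\<close>

lemma rotation_graph_dist:
  assumes "search_tree (gr S) T" "search_tree (gr S) U"
  defines "d \<equiv> graph_dist (with_proj (rotation_graph (gr S))) T U"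
  shows "d \<le> B" and "(tubes T, tubes U) \<in> rotations S ^^ d"
proof -
  let ?R = "arcs_ends (with_proj (rotation_graph (gr S)))"
  obtain xs ys where "distinct xs" "set xs = S" "tubing xs = tubes T"
      "distinct ys" "set ys = S" "tubing ys = tubes U"
    using tubing_of_search_tree[OF assms(1) fin con] tubing_of_search_tree[OF assms(2) fin con] by blast
  then obtain j where j: "j \<le> B" "(tubes T, tubes U) \<in> rotations S ^^ j"
    using bound[of xs ys] by (auto simp: steps_le_def)
  then have TU: "(T, U) \<in> ?R ^^ j" using relpow_tubes_rotations[OF con assms(1,2)] by blast
  have d: "d = (LEAST k. (T, U) \<in> ?R ^^ k)" by (simp add: d_def graph_dist_def)
  show "d \<le> B" unfolding d using Least_le[where P = "\<lambda>k. (T, U) \<in> ?R ^^ k", OF TU] j(1) by linarith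
  have "(T, U) \<in> ?R ^^ d" unfolding d by (rule LeastI[where P = "\<lambda>k. (T, U) \<in> ?R ^^ k", OF TU])
  then show "(tubes T, tubes U) \<in> rotations S ^^ d" by (rule relpow_rotations_tubes[OF fin con])
qed

lemma verts_rotation_graph: "verts (with_proj (rotation_graph (gr S))) = {T. search_tree (gr S) T}"
  by (simp add: rotation_graph_def)

lemma dists_subset:
  "{graph_dist (with_proj (rotation_graph (gr S))) u v | u v.
    u \<in> verts (with_proj (rotation_graph (gr S))) \<and> v \<in> verts (with_proj (rotation_graph (gr S)))} \<subseteq> {..B}"
  unfolding verts_rotation_graph using rotation_graph_dist(1) by auto

lemma finite_dists:
  "finite {graph_dist (with_proj (rotation_graph (gr S))) u v | u v.
    u \<in> verts (with_proj (rotation_graph (gr S))) \<and> v \<in> verts (with_proj (rotation_graph (gr S)))}"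
  by (rule finite_subset[OF dists_subset]) simp

lemma associahedron_diameter_le: "associahedron_diameter (gr S) \<le> B"
proof -
  obtain xs where xs: "distinct xs" "set xs = S" using finite_distinct_list[OF fin] by blast
  then obtain T where "search_tree (gr S) T" using search_tree_of_tubing[of xs] con by auto
  then have "{graph_dist (with_proj (rotation_graph (gr S))) u v | u v.
    u \<in> verts (with_proj (rotation_graph (gr S))) \<and> v \<in> verts (with_proj (rotation_graph (gr S)))} \<noteq> {}"
    unfolding verts_rotation_graph by blast
  then show ?thesis
    unfolding associahedron_diameter_def graph_diameter_def
    using Max_in[OF finite_dists] dists_subset by blast
qed

lemma associahedron_diameter_ge:
  assumes "distinct xs" "set xs = S" "sorted_wrt R xs" "asymp R"
  shows "card {(u, v) \<in> E \<inter> S \<times> S. R u v} \<le> associahedron_diameter (gr S)"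
proof -
  obtain T where T: "search_tree (gr S) T" "tubes T = tubing xs"
    using search_tree_of_tubing[of xs] con assms by auto
  obtain U where U: "search_tree (gr S) U" "tubes U = tubing (rev xs)"
    using search_tree_of_tubing[of "rev xs"] con assms by auto
  let ?d = "graph_dist (with_proj (rotation_graph (gr S))) T U"
  have "(tubing xs, tubing (rev xs)) \<in> rotations S ^^ ?d"
    using rotation_graph_dist(2)[OF T(1) U(1)] T(2) U(2) by simp
  then have "card {(u, v) \<in> E \<inter> S \<times> S. R u v} \<le> ?d"
    using assms by (rule edges_le_rotations)
  also have "?d \<le> associahedron_diameter (gr S)"
    unfolding associahedron_diameter_def graph_diameter_def
    by (rule Max_ge[OF finite_dists]) (use T(1) U(1) verts_rotation_graph in blast)
  finally show ?thesis .
qed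

end

end

section \<open>Pathwidth\<close>

lemma clique_card_le_clique_number:
  assumes "finite (pverts H)" "clique H K"
  shows "card K \<le> clique_number H"
proof -
  have "{card K | K. clique H K} \<subseteq> card ` Pow (pverts H)" by (auto simp: clique_def)
  then have "finite {card K | K. clique H K}" 
    by (rule finite_subset) (use assms(1) in simp)
  then show ?thesis unfolding clique_number_def using assms(2) by (intro Max_ge) auto
qed

lemma interval_graph_complete:
  assumes "finite V"
  shows "interval_graph \<lparr>pverts = V, parcs = {(u, v). u \<in> V \<and> v \<in> V \<and> u \<noteq> v}\<rparr>" (is "interval_graph ?H")
proof -
  have "finite {(u, v). u \<in> V \<and> v \<in> V \<and> u \<noteq> v}"
    by (rule finite_subset[of _ "V \<times> V"]) (use assms in auto)
  then have "pair_graph ?H"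
    by unfold_locales (use assms in \<open>auto simp: symmetric_def sym_def\<close>)
  then show ?thesis
    unfolding interval_graph_def by (auto intro!: exI[of _ "\<lambda>_. 0 :: real"])
qed

text \<open>The complete graph on the vertices is an interval supergraph, so the minimum is
  attained. An inequality is stated because the subtraction in \<open>pathwidth\<close> truncates at
  zero.\<close>

lemma pathwidth_interval_supergraph:
  assumes "pair_graph G"
  obtains H where "interval_graph H" "subgraph (with_proj G) (with_proj H)"
    "clique_number H \<le> pathwidth G + 1"
proof -
  interpret pair_graph G by fact
  let ?P = "\<lambda>w. \<exists>H. interval_graph H \<and> subgraph (with_proj G) (with_proj H) \<and> clique_number H = w"
  let ?H = "\<lparr>pverts = pverts G, parcs = {(u, v). u \<in> pverts G \<and> v \<in> pverts G \<and> u \<noteq> v}\<rparr>"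
  have H: "interval_graph ?H" by (rule interval_graph_complete[OF pair_finite_verts])
  then interpret H: pair_graph ?H by (simp add: interval_graph_def)
  have "parcs G \<subseteq> parcs ?H" using in_arcsD1 in_arcsD2 pair_no_loops by fastforce
  then have "subgraph (with_proj G) (with_proj ?H)"
    using wf_digraph H.wf_digraph by (simp add: subgraph_def compatible_def)
  then have "?P (clique_number ?H)" using H by blast
  then have "?P (LEAST w. ?P w)" by (rule LeastI)
  then obtain H where "interval_graph H" "subgraph (with_proj G) (with_proj H)"
    "clique_number H = (LEAST w. ?P w)" by blast
  then show ?thesis using that[of H] by (simp add: pathwidth_def)
qed

lemma pathwidth_le:
  assumes "interval_graph H" "subgraph (with_proj G) (with_proj H)" "clique_number H \<le> k + 1"
  shows "pathwidth G \<le> k"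
proof -
  have "(LEAST w. \<exists>H. interval_graph H \<and> subgraph (with_proj G) (with_proj H) \<and> clique_number H = w)
      \<le> clique_number H"
    by (rule Least_le) (use assms in blast)
  then show ?thesis using assms(3) by (simp add: pathwidth_def)
qed

section \<open>The upper bound\<close>

lemma sym_relation_parcs: "pair_graph G \<Longrightarrow> sym_relation (parcs G)"
  by (auto simp: pair_graph_def pair_pseudo_graph_def pair_sym_digraph_def pair_sym_digraph_axioms_def
      symmetric_def intro!: sym_relation.intro)

lemma gr_pverts:
  assumes "pair_graph G"
  shows "sym_relation.gr (parcs G) (pverts G) = with_proj G"
proof -
  interpret pair_graph G by fact
  have "parcs G \<inter> pverts G \<times> pverts G = parcs G" using in_arcsD1 in_arcsD2 by fastforce
  then show ?thesis by (simp add: sym_relation.gr_def[OF sym_relation_parcs[OF assms]])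
qed

lemma connected_set_pverts:
  assumes "pair_graph G" "Digraph_Component.connected (with_proj G)"
  shows "sym_relation.connected_set (parcs G) (pverts G)"
proof -
  interpret pair_graph G by fact
  interpret sym_relation "parcs G" by (rule sym_relation_parcs[OF assms(1)])
  have "strongly_connected (with_proj G)"
    using symmetric_connected_imp_strongly_connected[OF pair_sym_arcs assms(2)] .
  then show ?thesis using strongly_connected_gr[of "pverts G"] gr_pverts[OF assms(1)] by simp
qed

text \<open>Any two orders are joined through one order of small weight obtained from an interval
  supergraph, which accounts for the factor two.\<close>

lemma tubing_steps_le:
  assumes "pair_graph G" "card (pverts G) < 2 ^ L"
    and "distinct xs" "distinct ys" "set xs = pverts G" "set ys = pverts G"
  shows "(sym_relation.tubing (parcs G) xs, sym_relation.tubing (parcs G) ys)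
    \<in> steps_le (sym_relation.rotations (parcs G) (pverts G)) (2 * ((pathwidth G + 1) * L * card (pverts G)))"
proof -
  interpret pair_graph G by fact
  interpret sym_relation "parcs G" by (rule sym_relation_parcs[OF assms(1)])
  let ?V = "pverts G" and ?w = "pathwidth G + 1"
  obtain H where H: "interval_graph H" "subgraph (with_proj G) (with_proj H)" "clique_number H \<le> ?w"
    using pathwidth_interval_supergraph[OF assms(1)] by blast
  have VH: "?V \<subseteq> pverts H" "parcs G \<subseteq> parcs H" using H(2) by (auto simp: subgraph_def)
  obtain a b :: "'a \<Rightarrow> real" where ab': "\<forall>v \<in> pverts H. a v \<le> b v"
      "\<forall>u \<in> pverts H. \<forall>v \<in> pverts H. u \<noteq> v \<longrightarrow>
        ((u, v) \<in> parcs H \<longleftrightarrow> {a u..b u} \<inter> {a v..b v} \<noteq> {})"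
    using H(1) unfolding interval_graph_def by (elim conjE exE) (rule that)
  have ab: "a v \<le> b v" if "v \<in> pverts H" for v using ab'(1) that by blast
  have ab2: "(u, v) \<in> parcs H \<longleftrightarrow> {a u..b u} \<inter> {a v..b v} \<noteq> {}"
    if "u \<in> pverts H" "v \<in> pverts H" "u \<noteq> v" for u v using ab'(2) that by simp
  have finH: "finite (pverts H)"
    using H(1) by (simp add: interval_graph_def pair_graph_def pair_digraph_def pair_fin_digraph_def
        pair_fin_digraph_axioms_def)
  have "\<exists>zs. distinct zs \<and> set zs = ?V \<and> weight zs \<le> ?w * L * card ?V"
  proof (rule order_with_small_weight[of ?V a b])
    show "finite ?V" by (rule pair_finite_verts)
    show "{a u..b u} \<inter> {a v..b v} \<noteq> {}" if "u \<in> ?V" "v \<in> ?V" "(u, v) \<in> parcs G" "u \<noteq> v" for u v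
      using ab2[of u v] that VH by blast
    show "a v \<le> b v" if "v \<in> ?V" for v using ab that VH by blast
    \<comment> \<open>Intervals through a common point meet pairwise, so these vertices form a
      clique of \<open>H\<close>.\<close>
    show "card {v \<in> ?V. a v \<le> x \<and> x \<le> b v} \<le> ?w" for x
    proof -
      have "(u, v) \<in> parcs H"
        if "u \<in> ?V" "v \<in> ?V" "a u \<le> x" "x \<le> b u" "a v \<le> x" "x \<le> b v" "u \<noteq> v" for u v
      proof -
        have "x \<in> {a u..b u} \<inter> {a v..b v}" using that by simp
        then have "{a u..b u} \<inter> {a v..b v} \<noteq> {}" by blast
        moreover have "u \<in> pverts H" "v \<in> pverts H" using that VH by auto
        ultimately show ?thesis using ab2[of u v] that(7) by blast
      qed
      then have "clique H {v \<in> ?V. a v \<le> x \<and> x \<le> b v}"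
        using VH(1) unfolding clique_def by auto
      then show ?thesis using clique_card_le_clique_number[OF finH] H(3) by fastforce
    qed
    show "card (conn ?V v) < 2 ^ L" if "v \<in> ?V" for v
      using card_mono[OF pair_finite_verts conn_subset, of v] assms(2) by linarith
  qed
  then obtain zs where zs: "distinct zs" "set zs = ?V" "weight zs \<le> ?w * L * card ?V" by blast
  have to_zs: "(tubing us, tubing zs) \<in> steps_le (rotations ?V) (?w * L * card ?V)"
    if "distinct us" "set us = ?V" for us
    using tubing_steps_weight[of us zs] that zs steps_le_mono by metis
  have "(tubing xs, tubing zs) \<in> steps_le (rotations ?V) (?w * L * card ?V)"
    by (rule to_zs[OF assms(3,5)])
  moreover have "(tubing zs, tubing ys) \<in> steps_le (rotations ?V) (?w * L * card ?V)"
    by (rule steps_le_sym[OF sym_rotations to_zs[OF assms(4,6)]])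
  ultimately show ?thesis unfolding mult_2 by (rule steps_le_trans)
qed

lemma associahedron_diameter_upper:
  assumes "pair_graph G" "Digraph_Component.connected (with_proj G)" "card (pverts G) < 2 ^ L"
  shows "associahedron_diameter (with_proj G) \<le> 2 * ((pathwidth G + 1) * L * card (pverts G))"
proof -
  interpret pair_graph G by fact
  interpret sym_relation "parcs G" by (rule sym_relation_parcs[OF assms(1)])
  have "associahedron_diameter (gr (pverts G)) \<le> 2 * ((pathwidth G + 1) * L * card (pverts G))"
    by (rule associahedron_diameter_le[OF pair_finite_verts connected_set_pverts[OF assms(1,2)]])
      (rule tubing_steps_le[OF assms(1,3)])
  then show ?thesis by (simp only: gr_pverts[OF assms(1)])
qed

lemma associahedron_diameter_lower:
  assumes "pair_graph G" "Digraph_Component.connected (with_proj G)"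
    and "distinct xs" "set xs = pverts G" "sorted_wrt R xs" "asymp R"
  shows "card {(u, v) \<in> parcs G. R u v} \<le> associahedron_diameter (with_proj G)"
proof -
  interpret pair_graph G by fact
  interpret sym_relation "parcs G" by (rule sym_relation_parcs[OF assms(1)])
  have "card {(u, v) \<in> parcs G \<inter> pverts G \<times> pverts G. R u v} \<le> associahedron_diameter (gr (pverts G))"
  proof (rule associahedron_diameter_ge[OF pair_finite_verts connected_set_pverts[OF assms(1,2)]])
    \<comment> \<open>A crude bound, with \<open>L\<close> the number of vertices, is enough to make
      the distances and their maximum well defined.\<close>
    show "(tubing us, tubing vs) \<in> steps_le (rotations (pverts G))
        (2 * ((pathwidth G + 1) * card (pverts G) * card (pverts G)))"
      if "distinct us" "distinct vs" "set us = pverts G" "set vs = pverts G" for us vs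
      by (rule tubing_steps_le[OF assms(1) _ that]) simp
  qed (fact assms)+
  moreover have "parcs G \<inter> pverts G \<times> pverts G = parcs G" using in_arcsD1 in_arcsD2 by fastforce
  ultimately show ?thesis by (simp only: gr_pverts[OF assms(1)])
qed

section \<open>Complete split graphs\<close>

definition split_graph :: "nat \<Rightarrow> nat \<Rightarrow> nat pair_pre_digraph" where
  "split_graph n k =
    \<lparr>pverts = {..<n}, parcs = {(u, v). u < n \<and> v < n \<and> u \<noteq> v \<and> (u < k \<or> v < k)}\<rparr>"

lemma split_graph_simps [simp]:
  "pverts (split_graph n k) = {..<n}"
  "parcs (split_graph n k) = {(u, v). u < n \<and> v < n \<and> u \<noteq> v \<and> (u < k \<or> v < k)}"
  by (simp_all add: split_graph_def)

lemma pair_graph_split_graph: "pair_graph (split_graph n k)"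
proof -
  have "finite (parcs (split_graph n k))"
    by (rule finite_subset[of _ "{..<n} \<times> {..<n}"]) auto
  then show ?thesis by unfold_locales (auto simp: symmetric_def sym_def)
qed

lemma connected_split_graph:
  assumes "0 < k" "0 < n"
  shows "Digraph_Component.connected (with_proj (split_graph n k))"
proof -
  let ?G = "split_graph n k" and ?V = "{..<n}"
  interpret pair_graph ?G by (rule pair_graph_split_graph)
  interpret sym_relation "parcs ?G" by (rule sym_relation_parcs[OF pair_graph_split_graph])
  have "conn ?V v = ?V" if v: "v \<in> ?V" for v
  proof
    have "0 \<in> conn ?V v"
      using conn_step[OF conn_self[OF v], of 0] conn_self[OF v] v assms by (cases "v = 0") auto
    then show "?V \<subseteq> conn ?V v"
      using conn_step[of 0 ?V v] assms by fastforce
  qed (rule conn_subset)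
  then have "connected_set ?V" using assms(2) unfolding connected_set_def by blast
  then have "strongly_connected (with_proj ?G)"
    using strongly_connected_gr[of ?V] gr_pverts[OF pair_graph_split_graph[of n k]]
    unfolding split_graph_simps(1) by metis
  moreover have "mk_symmetric (with_proj ?G) = ?G"
    by (rule pair_pre_digraph.equality) (auto simp: mk_symmetric_def)
  ultimately show ?thesis by (simp add: Digraph_Component.connected_def)
qed

text \<open>The graph is its own interval supergraph: clique vertices get the whole range and every
  other vertex a single point. A clique has at most one vertex outside
  \<open>{..<k}\<close>.\<close>

lemma pathwidth_split_graph: "pathwidth (split_graph n k) \<le> k"
proof (rule pathwidth_le)
  let ?G = "split_graph n k"
  let ?a = "\<lambda>v. if v < k then 0 else real v" and ?b = "\<lambda>v. if v < k then real n else real v"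
  interpret pair_graph ?G by (rule pair_graph_split_graph)
  have "(u, v) \<in> parcs ?G \<longleftrightarrow> {?a u..?b u} \<inter> {?a v..?b v} \<noteq> {}" if "u < n" "v < n" "u \<noteq> v" for u v
    using that by (auto simp: not_less)
  then show "interval_graph ?G"
    unfolding interval_graph_def using pair_graph_split_graph
    by (intro conjI exI[of _ ?a] exI[of _ ?b]) auto
  show "subgraph (with_proj ?G) (with_proj ?G)"
    using wf_digraph by (simp add: subgraph_def compatible_def)
  have card_clique: "card K \<le> k + 1" if K: "clique ?G K" for K
  proof -
    have fin: "finite K" using K finite_subset[of K "{..<n}"] by (auto simp: clique_def)
    have "u = v" if "u \<in> K - {..<k}" "v \<in> K - {..<k}" for u v
      using K that by (auto simp: clique_def)
    then have "card (K - {..<k}) \<le> Suc 0"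
      using fin by (subst card_le_Suc0_iff_eq) auto
    moreover have "card (K \<inter> {..<k}) \<le> card {..<k}" by (rule card_mono) auto
    moreover have "card K = card (K \<inter> {..<k}) + card (K - {..<k})"
      using fin card_Int_Diff by blast
    ultimately show ?thesis by simp
  qed
  have "{card K | K. clique ?G K} \<subseteq> {..k + 1}" using card_clique by auto
  moreover have "clique ?G {}" by (simp add: clique_def)
  then have "{card K | K. clique ?G K} \<noteq> {}" by blast
  ultimately show "clique_number ?G \<le> k + 1"
    unfolding clique_number_def using Max_in[of "{card K | K. clique ?G K}"] finite_subset by blast
qed

lemma split_graph_edges:
  assumes "k < n"
  shows "k * n \<le> 2 * card {(u, v) \<in> parcs (split_graph n k). u < v}"
proof -
  have "{(u, v) \<in> parcs (split_graph n k). u < v} = (SIGMA u:{..<k}. {u<..<n})"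
    using assms by auto
  then have card: "card {(u, v) \<in> parcs (split_graph n k). u < v} = (\<Sum>u<k. n - 1 - u)"
    by (simp add: card_SigmaI)
  \<comment> \<open>The closed form has a sum on the left to avoid truncated subtraction;
    \<open>k + 1 \<le> n\<close> then leaves at least \<open>k * n\<close>.\<close>
  have "2 * (\<Sum>u<j. n - 1 - u) + j * (j + 1) = 2 * (j * n)" if "j \<le> n" for j
    using that
  proof (induction j)
    case (Suc j)
    then obtain m where "n = Suc j + m" using le_Suc_ex by blast
    with Suc show ?case by (simp add: algebra_simps)
  qed simp
  from this[of k] have "2 * (\<Sum>u<k. n - 1 - u) + k * (k + 1) = 2 * (k * n)" using assms by simp
  moreover have "k * (k + 1) \<le> k * n" using assms by (intro mult_le_mono) auto
  ultimately show ?thesis unfolding card by linarith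
qed

section \<open>The maximum diameter\<close>

lemma split_graph_in_family:
  assumes "1 \<le> k" "k \<le> pw n" "0 < n"
  shows "split_graph n k \<in> pathwidth_family pw" and "card (pverts (split_graph n k)) = n"
  using assms pair_graph_split_graph connected_split_graph pathwidth_split_graph[of n k]
  by (auto simp: pathwidth_family_def intro: order_trans)

lemma associahedron_diameter_family_le:
  assumes "G \<in> pathwidth_family pw" "card (pverts G) = n" "n < 2 ^ L"
  shows "associahedron_diameter (with_proj G) \<le> 2 * ((pw n + 1) * L * n)"
proof -
  have G: "pair_graph G" "Digraph_Component.connected (with_proj G)" "pathwidth G \<le> pw n"
    using assms(1,2) by (auto simp: pathwidth_family_def)
  have "associahedron_diameter (with_proj G) \<le> 2 * ((pathwidth G + 1) * L * n)"
    using associahedron_diameter_upper[OF G(1,2)] assms(2,3) by blast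
  also have "\<dots> \<le> 2 * ((pw n + 1) * L * n)" using G(3) by (intro mult_le_mono) auto
  finally show ?thesis .
qed

lemma finite_diameters:
  "finite {associahedron_diameter (with_proj G) | G. G \<in> pathwidth_family pw \<and> card (pverts G) = n}"
proof (rule finite_subset)
  show "{associahedron_diameter (with_proj G) | G. G \<in> pathwidth_family pw \<and> card (pverts G) = n}
      \<subseteq> {..2 * ((pw n + 1) * n * n)}"
    \<comment> \<open>The exponent \<open>L = n\<close> is admissible because
      \<open>n < 2 ^ n\<close>.\<close>
    using associahedron_diameter_family_le[of _ pw n n] by auto
qed simp

lemma max_diameter_upper:
  assumes "1 \<le> pw n" "0 < n" "n < 2 ^ L"
  shows "max_diameter (pathwidth_family pw) n \<le> 2 * ((pw n + 1) * L * n)"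
proof -
  \<comment> \<open>With \<open>k = 1\<close> the split graph is a star, so the family has a member
    on \<open>n\<close> vertices.\<close>
  have "{associahedron_diameter (with_proj G) | G. G \<in> pathwidth_family pw \<and> card (pverts G) = n} \<noteq> {}"
    using split_graph_in_family[of 1 pw n] assms by blast
  from Max_in[OF finite_diameters this] show ?thesis
    unfolding max_diameter_def using associahedron_diameter_family_le[of _ pw n L] assms(3) by auto
qed

lemma max_diameter_lower:
  assumes "1 \<le> pw n" "pw n < n"
  shows "pw n * n \<le> 2 * max_diameter (pathwidth_family pw) n"
proof -
  let ?G = "split_graph n (pw n)"
  have G: "?G \<in> pathwidth_family pw" "card (pverts ?G) = n"
    using split_graph_in_family[of "pw n" pw n] assms by auto
  have "card {(u, v) \<in> parcs ?G. u < v} \<le> associahedron_diameter (with_proj ?G)"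
  proof (rule associahedron_diameter_lower)
    show "set [0..<n] = pverts ?G" by auto
    show "asymp ((<) :: nat \<Rightarrow> _)" by (auto intro: asympI)
  qed (use assms in \<open>auto intro: pair_graph_split_graph connected_split_graph\<close>)
  also have "\<dots> \<le> max_diameter (pathwidth_family pw) n"
    unfolding max_diameter_def by (rule Max_ge[OF finite_diameters]) (use G in blast)
  finally show ?thesis using split_graph_edges[OF assms(2)] by linarith
qed

text \<open>A connected graph of pathwidth zero has a single vertex, so \<open>pw n \<ge> 1\<close>
  keeps the family inhabited. Diameters are at most quadratic in \<open>n\<close>, so a lower bound
  linear in \<open>pw n\<close> calls for a restriction such as \<open>pw n < n\<close>.\<close>

theorem theorem6:
  fixes pw :: "nat \<Rightarrow> nat"
  assumes "\<forall>\<^sub>F n in at_top. pw n \<ge> 1"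
  shows "((\<forall>\<^sub>F n in at_top. pw n < n) \<longrightarrow>
           (\<lambda>n. real (max_diameter (pathwidth_family pw) n)) \<in> \<Omega>(\<lambda>n. real (pw n) * real n))
       \<and> (\<lambda>n. real (max_diameter (pathwidth_family pw) n)) \<in> O(\<lambda>n. real (pw n) * real n * ln (real n))"
proof (intro conjI impI)
  assume "\<forall>\<^sub>F n in at_top. pw n < n"
  with assms have "\<forall>\<^sub>F n in at_top. norm (real (max_diameter (pathwidth_family pw) n)) \<ge>
      1 / 2 * norm (real (pw n) * real n)"
  proof eventually_elim
    case (elim n)
    have "real (pw n * n) \<le> real (2 * max_diameter (pathwidth_family pw) n)"
      using max_diameter_lower[of pw n, OF elim] by (rule of_nat_mono)
    then show ?case by simp
  qed
  then show "(\<lambda>n. real (max_diameter (pathwidth_family pw) n)) \<in> \<Omega>(\<lambda>n. real (pw n) * real n)"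
    by (rule landau_omega.bigI[rotated]) simp
next
  \<comment> \<open>The constant is \<open>4 * 4\<close>: \<open>pw n + 1 \<le> 2 * pw n\<close>
    doubles the factor two, and \<open>l + 1 \<le> 4 * ln n\<close>.\<close>
  have "\<forall>\<^sub>F n in at_top. norm (real (max_diameter (pathwidth_family pw) n)) \<le>
      16 * norm (real (pw n) * real n * ln (real n))"
    using assms eventually_ge_at_top[of 2]
  proof eventually_elim
    case (elim n)
    \<comment> \<open>The binary logarithm rounded down; \<open>L = l + 1\<close> is then admissible
      in the upper bound.\<close>
    obtain l where l: "2 ^ l \<le> n" "n < 2 ^ (l + 1)" using ex_power_ivl1[of 2 n] elim(2) by auto
    have ln2: "1 / 2 \<le> ln (2 :: real)" using ln_le_minus_one[of "1 / 2 :: real"] by (simp add: ln_div)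
    have "real l * ln 2 = ln (2 ^ l)" by (simp add: ln_realpow)
    also have "\<dots> \<le> ln (real n)"
      using l(1) elim(2) by (subst ln_le_cancel_iff) (simp_all add: numeral_power_le_of_nat_cancel_iff)
    finally have "real l * ln 2 \<le> ln (real n)" .
    \<comment> \<open>Since \<open>n \<ge> 2\<close>, the extra summand one is absorbed by doubling
      the logarithm.\<close>
    moreover have "ln 2 \<le> ln (real n)" using elim(2) by simp
    ultimately have 1: "(real l + 1) * ln 2 \<le> 2 * ln (real n)" by (simp add: algebra_simps)
    have "(real l + 1) * (1 / 2) \<le> (real l + 1) * ln 2" using ln2 by (intro mult_left_mono) auto
    from order_trans[OF this 1] have L: "real l + 1 \<le> 4 * ln (real n)" by simp
    have "max_diameter (pathwidth_family pw) n \<le> 2 * ((pw n + 1) * (l + 1) * n)"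
      using max_diameter_upper[of pw n "l + 1"] elim l(2) by simp
    also have "\<dots> \<le> 2 * ((2 * pw n) * (l + 1) * n)"
      using elim(1) by (intro mult_le_mono) auto
    finally have "real (max_diameter (pathwidth_family pw) n) \<le> real (2 * ((2 * pw n) * (l + 1) * n))"
      by (rule of_nat_mono)
    also have "\<dots> = 4 * (real (pw n) * real n) * (real l + 1)" by (simp add: algebra_simps)
    also have "\<dots> \<le> 4 * (real (pw n) * real n) * (4 * ln (real n))"
      using L by (intro mult_left_mono) auto
    finally show ?case using elim(2) by (simp add: abs_mult)
  qed
  then show "(\<lambda>n. real (max_diameter (pathwidth_family pw) n)) \<in> O(\<lambda>n. real (pw n) * real n * ln (real n))"
    by (rule bigoI)
qed

end
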